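(* Let \((G,\lambda,\mathcal{T})\) be any instance of Time Disjoint Walks in which \(G\) is an oriented star. Then the Central Slot Allocation algorithm described in the context runs in time polynomial in the input size, and, regardless of how ties are broken, its output is a feasible solution that is optimal for min-sum Time Disjoint Walks, i.e. it minimizes \(\sum_{i\in[k]}(d_i+\lambda(W_i))\) over all feasible solutions.
   Context: Notation: for integers \(a,b\), \([a,b]=\{x\in\mathbb{Z}: a\le x\le b\}\) and \([b]=[1,b]\). Digraphs are finite and have no parallel arcs in the same direction. Let \(G=(V,E)\) be a digraph with arc lengths \(\lambda:E\to\mathbb{Z}_{\ge1}\). A walk from \(u\) to \(v\) is a tuple \(W=(w_1,\dots,w_l)\) of vertices with \(w_1=u\), \(w_l=v\), \((w_i,w_{i+1})\in E\) for all \(i\in[l-1]\) (vertices may repeat). For \(j\in[l]\) let \(\lambda(W,j)=\sum_{i\in[j-1]}\lambda(w_i,w_{i+1})\) and \(\lambda(W)=\lambda(W,l)\). Given delays \(d_1,d_2\in\mathbb{Z}_{\ge0}\) and walks \(W_1,W_2\), the pairs \((d_1,W_1)\) and \((d_2,W_2)\) are time disjoint if for every \(j_1\in[|W_1|]\), \(j_2\in[|W_2|]\) such that the \(j_1\)-th vertex of \(W_1\) equals the \(j_2\)-th vertex of \(W_2\), we have \(d_1+\lambda(W_1,j_1)\ne d_2+\lambda(W_2,j_2)\). Time Disjoint Walks (TDW): an instance is \((G,\lambda,\mathcal{T})\) with \(\mathcal{T}=\{(s_1,t_1),\dots,(s_k,t_k)\}\subseteq V^2\) a set of \(k\) demands across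 unique vertices, such that for each \(i\) there is a walk from \(s_i\) to \(t_i\). A feasible solution is a choice, for each \(i\in[k]\), of a delay \(d_i\in\mathbb{Z}_{\ge0}\) and a walk \(W_i\) from \(s_i\) to \(t_i\), such that the pairs \((d_i,W_i)\) are pairwise time disjoint. Min-sum TDW minimizes \(\sum_{i\in[k]}(d_i+\lambda(W_i))\); min-max TDW minimizes \(\max_{i\in[k]}(d_i+\lambda(W_i))\). An oriented star is a digraph consisting of a central vertex \(x\) and any number of leaves, each joined to \(x\) by a single arc (oriented either way), i.e. an orientation of \(K_{1,n-1}\). Central Slot Allocation algorithm (input an oriented star instance with central vertex \(x\)): for each \(i\in[k]\), let \(W_i=(s_i,x,t_i)\), \(a_i=\lambda(s_i,x)\), \(b_i=\lambda(x,t_i)\); if \(s_i=x\) instead \(W_i=(s_i,t_i)\), \(a_i=0\), \(b_i=\lambda(x,t_i)\), and if \(t_i=x\) instead \(W_i=(s_i,t_i)\), \(a_i=\lambda(s_i,x)\), \(b_i=0\). Set \(U=[k]\) and \(O=\emptyset\). While \(U\neq\emptyset\): let \(m=\min_{i\in U}a_i\); let \(\sigma\) be the least integer \(s\ge m\) with \(s\notin O\); choose \(i^\ast\in\{i\in U: a_i\le\sigma\}\) maximizing \(b_{i^\ast}\) (ties broken arbitrarily); set \(d_{i^\ast}=\sigma-a_{i^\ast}\); remove \(i^\ast\) from \(U\) and add \(\sigma\) to \(O\). Output \(\{(d_i,W_i): i\in[k]\}\). *)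

theory Defs
  imports
    "Graph_Theory.Graph_Theory"
    "HOL-Library.Log_Nat"
    "HOL-Library.Stream"
    "HOL-Computational_Algebra.Polynomial"
begin

section \<open>Time Disjoint Walks\<close>

text \<open>
  A pair digraph has its arcs as a set of ordered pairs, so there are no parallel arcs.  Walks are
  nonempty vertex lists (predicate \<^const>\<open>vwalk\<close>), positions are counted from 0, and the demands
  \<open>\<T> = {(s_0,t_0),...,(s_{k-1},t_{k-1})}\<close> are given as a list of length \<open>k\<close>.
\<close>

definition walk_time :: "('v \<times> 'v \<Rightarrow> nat) \<Rightarrow> 'v list \<Rightarrow> nat \<Rightarrow> nat" where
  "walk_time len W j = (\<Sum>i<j. len (W ! i, W ! Suc i))"

definition walk_len :: "('v \<times> 'v \<Rightarrow> nat) \<Rightarrow> 'v list \<Rightarrow> nat" where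
  "walk_len len W = walk_time len W (length W - 1)"

definition walk_from_to :: "'v pair_pre_digraph \<Rightarrow> 'v \<Rightarrow> 'v list \<Rightarrow> 'v \<Rightarrow> bool" where
  "walk_from_to G u W v \<longleftrightarrow> vwalk W (with_proj G) \<and> hd W = u \<and> last W = v"

definition time_disjoint ::
    "('v \<times> 'v \<Rightarrow> nat) \<Rightarrow> nat \<Rightarrow> 'v list \<Rightarrow> nat \<Rightarrow> 'v list \<Rightarrow> bool" where
  "time_disjoint len d1 W1 d2 W2 \<longleftrightarrow>
     (\<forall>j1<length W1. \<forall>j2<length W2. W1 ! j1 = W2 ! j2 \<longrightarrow>
        d1 + walk_time len W1 j1 \<noteq> d2 + walk_time len W2 j2)"

definition tdw_instance ::
    "'v pair_pre_digraph \<Rightarrow> ('v \<times> 'v \<Rightarrow> nat) \<Rightarrow> ('v \<times> 'v) list \<Rightarrow> bool" where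
  "tdw_instance G len T \<longleftrightarrow>
     pair_fin_digraph G \<and>
     (\<forall>e\<in>parcs G. 1 \<le> len e) \<and>
     set T \<subseteq> pverts G \<times> pverts G \<and>
     distinct (map fst T @ map snd T) \<and>
     (\<forall>(s, t)\<in>set T. \<exists>W. walk_from_to G s W t)"

text \<open>
  A solution is a pair \<open>(d, W)\<close> of delays and walks, indexed by the demands \<open>i < k\<close>;
  the values at other indices are irrelevant.
\<close>

type_synonym 'v solution = "(nat \<Rightarrow> nat) \<times> (nat \<Rightarrow> 'v list)"

definition feasible ::
    "'v pair_pre_digraph \<Rightarrow> ('v \<times> 'v \<Rightarrow> nat) \<Rightarrow> ('v \<times> 'v) list \<Rightarrow> 'v solution \<Rightarrow> bool" where
  "feasible G len T = (\<lambda>(d, W).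
     (\<forall>i<length T. walk_from_to G (fst (T ! i)) (W i) (snd (T ! i))) \<and>
     (\<forall>i<length T. \<forall>j<length T. i \<noteq> j \<longrightarrow> time_disjoint len (d i) (W i) (d j) (W j)))"

definition sum_cost ::
    "('v \<times> 'v \<Rightarrow> nat) \<Rightarrow> ('v \<times> 'v) list \<Rightarrow> 'v solution \<Rightarrow> nat" where
  "sum_cost len T = (\<lambda>(d, W). \<Sum>i<length T. d i + walk_len len (W i))"

definition oriented_star :: "'v pair_pre_digraph \<Rightarrow> 'v \<Rightarrow> bool" where
  "oriented_star G x \<longleftrightarrow>
     pair_fin_digraph G \<and> x \<in> pverts G \<and>
     (\<forall>(u, v)\<in>parcs G. u \<noteq> v \<and> (u = x \<or> v = x)) \<and>
     (\<forall>v\<in>pverts G - {x}. ((x, v) \<in> parcs G) \<noteq> ((v, x) \<in> parcs G))"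


section \<open>Central Slot Allocation\<close>

context
  fixes len :: "'v \<times> 'v \<Rightarrow> nat" and T :: "('v \<times> 'v) list" and x :: 'v
begin

definition csa_walk :: "nat \<Rightarrow> 'v list" where
  "csa_walk i = (case T ! i of (s, t) \<Rightarrow> if s = x \<or> t = x then [s, t] else [s, x, t])"

definition csa_a :: "nat \<Rightarrow> nat" where
  "csa_a i = (case T ! i of (s, t) \<Rightarrow> if s = x then 0 else len (s, x))"

definition csa_b :: "nat \<Rightarrow> nat" where
  "csa_b i = (case T ! i of (s, t) \<Rightarrow> if t = x then 0 else len (x, t))"

text \<open>One iteration of the main loop, on states \<open>(U, O, d)\<close>; any maximiser may be chosen.\<close>

inductive csa_step ::
    "nat set \<times> nat set \<times> (nat \<Rightarrow> nat) \<Rightarrow> nat set \<times> nat set \<times> (nat \<Rightarrow> nat) \<Rightarrow> bool" where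
  "\<lbrakk> U \<noteq> {};
     m = Min (csa_a ` U);
     \<sigma> = (LEAST s. m \<le> s \<and> s \<notin> Occ);
     i \<in> U; csa_a i \<le> \<sigma>;
     \<forall>j\<in>U. csa_a j \<le> \<sigma> \<longrightarrow> csa_b j \<le> csa_b i \<rbrakk>
   \<Longrightarrow> csa_step (U, Occ, d) (U - {i}, insert \<sigma> Occ, d(i := \<sigma> - csa_a i))"

definition csa_output :: "'v solution \<Rightarrow> bool" where
  "csa_output = (\<lambda>(d, W). W = csa_walk \<and>
     (\<exists>Occ. csa_step\<^sup>*\<^sup>* ({..<length T}, {}, \<lambda>_. 0) ({}, Occ, d)))"

end


section \<open>A random access machine with logarithmic cost\<close>

text \<open>
  To make sense of running time, the algorithm is also written as a program of a small
  imperative language.  The memory consists of finitely many named arrays of natural numbers (a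
  scalar is cell 0 of its array).  Every operation costs 1 plus the bit lengths of all numbers
  and addresses it handles, which is the logarithmic cost criterion of random access machines
  and hence polynomially related to Turing machine time.

  The command \<open>FLIP c1 c2\<close> is a nondeterministic choice, used for breaking ties. It is resolved by
  an arbitrary stream of bits, so that every execution is determined by its stream.
\<close>

datatype 'r aexp =
    N nat
  | Cell 'r "'r aexp"
  | Plus "'r aexp" "'r aexp"
  | Minus "'r aexp" "'r aexp"

datatype 'r bexp =
    Less "'r aexp" "'r aexp"
  | Equal "'r aexp" "'r aexp"
  | Neg "'r bexp"
  | Conj "'r bexp" "'r bexp"

datatype 'r com =
    SKIP
  | Store 'r "'r aexp" "'r aexp"  ("(_\<langle>_\<rangle> ::=/ _)" [1000, 0, 61] 61)
  | Seq "'r com" "'r com"  (infixr ";;" 60)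
  | Cond "'r bexp" "'r com" "'r com"  ("(IF _/ THEN _/ ELSE _)" [0, 0, 61] 61)
  | While "'r bexp" "'r com"  ("(WHILE _/ DO _)" [0, 61] 61)
  | Flip "'r com" "'r com"  ("(FLIP _/ _)" [62, 62] 61)

type_synonym 'r mem = "'r \<Rightarrow> nat \<Rightarrow> nat"

definition bits :: "nat \<Rightarrow> nat" where
  "bits n = floorlog 2 n"

primrec aval :: "'r aexp \<Rightarrow> 'r mem \<Rightarrow> nat" where
  "aval (N n) M = n"
| "aval (Cell r e) M = M r (aval e M)"
| "aval (Plus e f) M = aval e M + aval f M"
| "aval (Minus e f) M = aval e M - aval f M"

primrec acost :: "'r aexp \<Rightarrow> 'r mem \<Rightarrow> nat" where
  "acost (N n) M = 1 + bits n"
| "acost (Cell r e) M = acost e M + 1 + bits (aval e M) + bits (M r (aval e M))"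
| "acost (Plus e f) M = acost e M + acost f M + 1 + bits (aval e M) + bits (aval f M)"
| "acost (Minus e f) M = acost e M + acost f M + 1 + bits (aval e M) + bits (aval f M)"

primrec bval :: "'r bexp \<Rightarrow> 'r mem \<Rightarrow> bool" where
  "bval (Less e f) M \<longleftrightarrow> aval e M < aval f M"
| "bval (Equal e f) M \<longleftrightarrow> aval e M = aval f M"
| "bval (Neg b) M \<longleftrightarrow> \<not> bval b M"
| "bval (Conj b c) M \<longleftrightarrow> bval b M \<and> bval c M"

primrec bcost :: "'r bexp \<Rightarrow> 'r mem \<Rightarrow> nat" where
  "bcost (Less e f) M = acost e M + acost f M + 1 + bits (aval e M) + bits (aval f M)"
| "bcost (Equal e f) M = acost e M + acost f M + 1 + bits (aval e M) + bits (aval f M)"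
| "bcost (Neg b) M = bcost b M + 1"
| "bcost (Conj b c) M = bcost b M + bcost c M + 1"

text \<open>
  \<open>exec c M w t M' w'\<close>: from memory \<open>M\<close> and choice bits \<open>w\<close>, command \<open>c\<close> halts after total cost \<open>t\<close>
  with memory \<open>M'\<close> and unread choice bits \<open>w'\<close>.
\<close>

inductive exec ::
    "'r com \<Rightarrow> 'r mem \<Rightarrow> bool stream \<Rightarrow> nat \<Rightarrow> 'r mem \<Rightarrow> bool stream \<Rightarrow> bool" where
  Skip: "exec SKIP M w 1 M w"
| Store: "exec (r\<langle>e\<rangle> ::= f) M w
    (acost e M + acost f M + 1 + bits (aval e M) + bits (aval f M))
    (M(r := (M r)(aval e M := aval f M))) w"
| Seq: "exec c1 M w t1 M1 w1 \<Longrightarrow> exec c2 M1 w1 t2 M2 w2 \<Longrightarrow>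
    exec (c1 ;; c2) M w (t1 + t2) M2 w2"
| IfTrue: "bval b M \<Longrightarrow> exec c1 M w t M' w' \<Longrightarrow>
    exec (IF b THEN c1 ELSE c2) M w (bcost b M + 1 + t) M' w'"
| IfFalse: "\<not> bval b M \<Longrightarrow> exec c2 M w t M' w' \<Longrightarrow>
    exec (IF b THEN c1 ELSE c2) M w (bcost b M + 1 + t) M' w'"
| WhileFalse: "\<not> bval b M \<Longrightarrow> exec (WHILE b DO c) M w (bcost b M + 1) M w"
| WhileTrue: "bval b M \<Longrightarrow> exec c M w t1 M1 w1 \<Longrightarrow> exec (WHILE b DO c) M1 w1 t2 M2 w2 \<Longrightarrow>
    exec (WHILE b DO c) M w (bcost b M + 1 + t1 + t2) M2 w2"
| FlipTrue: "exec c1 M w t M' w' \<Longrightarrow> exec (FLIP c1 c2) M (True ## w) (1 + t) M' w'"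
| FlipFalse: "exec c2 M w t M' w' \<Longrightarrow> exec (FLIP c1 c2) M (False ## w) (1 + t) M' w'"

text \<open>A halting execution is the only one for its stream of choice bits.\<close>

lemma exec_deterministic:
  "exec c M w t M' w' \<Longrightarrow> exec c M w t2 M2 w2 \<Longrightarrow> t2 = t \<and> M2 = M' \<and> w2 = w'"
proof (induction arbitrary: t2 M2 w2 rule: exec.induct)
  case Skip
  from Skip.prems show ?case by cases auto
next
  case Store
  from Store.prems show ?case by cases auto
next
  case Seq
  from Seq.prems show ?case by cases ((use Seq.IH Seq.hyps in fastforce)+)
next
  case IfTrue
  from IfTrue.prems show ?case by cases ((use IfTrue.IH IfTrue.hyps in fastforce)+)
next
  case IfFalse
  from IfFalse.prems show ?case by cases ((use IfFalse.IH IfFalse.hyps in fastforce)+)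
next
  case WhileFalse
  from WhileFalse.prems show ?case by cases (use WhileFalse.hyps in auto)
next
  case WhileTrue
  from WhileTrue.prems show ?case by cases ((use WhileTrue.IH WhileTrue.hyps in fastforce)+)
next
  case FlipTrue
  from FlipTrue.prems show ?case by cases (use FlipTrue.IH in auto)
next
  case FlipFalse
  from FlipFalse.prems show ?case by cases (use FlipFalse.IH in auto)
qed


section \<open>Central Slot Allocation as a program\<close>

datatype reg =
    CENTER | NARCS | TAIL | HEAD | LEN | NDEM | SRC | DST     \<comment> \<open>input\<close>
  | DELAY | WSIZE | WALK0 | WALK1 | WALK2                      \<comment> \<open>output\<close>
  | AA | BB | INU | NU | OCC | NOCC                            \<comment> \<open>\<open>a\<close>, \<open>b\<close>, \<open>U\<close>, \<open>|U|\<close>, \<open>O\<close>, \<open>|O|\<close>\<close>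
  | II | JJ | LL | MM | SLOT | FOUND | BEST                   \<comment> \<open>auxiliary\<close>

abbreviation Var :: "reg \<Rightarrow> reg aexp" where
  "Var r \<equiv> Cell r (N 0)"

abbreviation Assign :: "reg \<Rightarrow> reg aexp \<Rightarrow> reg com"  ("(_ ::=/ _)" [1000, 61] 61) where
  "r ::= e \<equiv> r\<langle>N 0\<rangle> ::= e"

abbreviation FOR :: "reg \<Rightarrow> reg aexp \<Rightarrow> reg com \<Rightarrow> reg com"  ("(FOR _ < _/ DO _)" [1000, 0, 61] 61) where
  "FOR i < e DO c \<equiv>
     (i ::= N 0 ;; WHILE Less (Var i) e DO (c ;; i ::= Plus (Var i) (N 1)))"

text \<open>Looks up the length of the arc \<open>(u, v)\<close> in the arc list and stores it in \<open>LL\<close>.\<close>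

definition lookup_len :: "reg aexp \<Rightarrow> reg aexp \<Rightarrow> reg com" where
  "lookup_len u v =
     (FOR JJ < Var NARCS DO
        (IF Conj (Equal (Cell TAIL (Var JJ)) u) (Equal (Cell HEAD (Var JJ)) v)
         THEN LL ::= Cell LEN (Var JJ) ELSE SKIP))"

definition init_prog :: "reg com" where
  "init_prog =
     (FOR II < Var NDEM DO
       ((IF Equal (Cell SRC (Var II)) (Var CENTER) THEN
           (AA\<langle>Var II\<rangle> ::= N 0 ;;
            lookup_len (Var CENTER) (Cell DST (Var II)) ;;
            BB\<langle>Var II\<rangle> ::= Var LL ;;
            WSIZE\<langle>Var II\<rangle> ::= N 2 ;;
            WALK0\<langle>Var II\<rangle> ::= Cell SRC (Var II) ;;
            WALK1\<langle>Var II\<rangle> ::= Cell DST (Var II))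
         ELSE IF Equal (Cell DST (Var II)) (Var CENTER) THEN
           (lookup_len (Cell SRC (Var II)) (Var CENTER) ;;
            AA\<langle>Var II\<rangle> ::= Var LL ;;
            BB\<langle>Var II\<rangle> ::= N 0 ;;
            WSIZE\<langle>Var II\<rangle> ::= N 2 ;;
            WALK0\<langle>Var II\<rangle> ::= Cell SRC (Var II) ;;
            WALK1\<langle>Var II\<rangle> ::= Cell DST (Var II))
         ELSE
           (lookup_len (Cell SRC (Var II)) (Var CENTER) ;;
            AA\<langle>Var II\<rangle> ::= Var LL ;;
            lookup_len (Var CENTER) (Cell DST (Var II)) ;;
            BB\<langle>Var II\<rangle> ::= Var LL ;;
            WSIZE\<langle>Var II\<rangle> ::= N 3 ;;
            WALK0\<langle>Var II\<rangle> ::= Cell SRC (Var II) ;;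
            WALK1\<langle>Var II\<rangle> ::= Var CENTER ;;
            WALK2\<langle>Var II\<rangle> ::= Cell DST (Var II))) ;;
        INU\<langle>Var II\<rangle> ::= N 1)) ;;
     NU ::= Var NDEM ;;
     NOCC ::= N 0"

text \<open>\<open>m = min_{i \<in> U} a_i\<close>\<close>

definition min_prog :: "reg com" where
  "min_prog =
     FOUND ::= N 0 ;;
     FOR II < Var NDEM DO
       (IF Equal (Cell INU (Var II)) (N 1) THEN
          (IF Equal (Var FOUND) (N 0) THEN
             (MM ::= Cell AA (Var II) ;; FOUND ::= N 1)
           ELSE IF Less (Cell AA (Var II)) (Var MM) THEN
             MM ::= Cell AA (Var II)
           ELSE SKIP)
        ELSE SKIP)"

text \<open>The least \<open>\<sigma> \<ge> m\<close> with \<open>\<sigma> \<notin> O\<close>, by linear search\<close>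

definition slot_prog :: "reg com" where
  "slot_prog =
     SLOT ::= Var MM ;;
     FOUND ::= N 1 ;;
     WHILE Equal (Var FOUND) (N 1) DO
       (FOUND ::= N 0 ;;
        (FOR JJ < Var NOCC DO
           (IF Equal (Cell OCC (Var JJ)) (Var SLOT) THEN FOUND ::= N 1 ELSE SKIP)) ;;
        IF Equal (Var FOUND) (N 1) THEN SLOT ::= Plus (Var SLOT) (N 1) ELSE SKIP)"

text \<open>A maximiser of \<open>b_i\<close> over \<open>{i \<in> U. a_i \<le> \<sigma>}\<close>; ties are resolved by the choice bits.\<close>

definition choose_prog :: "reg com" where
  "choose_prog =
     FOUND ::= N 0 ;;
     FOR II < Var NDEM DO
       (IF Conj (Equal (Cell INU (Var II)) (N 1)) (Neg (Less (Var SLOT) (Cell AA (Var II)))) THEN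
          (IF Equal (Var FOUND) (N 0) THEN
             (BEST ::= Var II ;; FOUND ::= N 1)
           ELSE IF Less (Cell BB (Var BEST)) (Cell BB (Var II)) THEN
             BEST ::= Var II
           ELSE IF Equal (Cell BB (Var BEST)) (Cell BB (Var II)) THEN
             FLIP (BEST ::= Var II) SKIP
           ELSE SKIP)
        ELSE SKIP)"

definition csa_prog :: "reg com" where
  "csa_prog =
     init_prog ;;
     WHILE Less (N 0) (Var NU) DO
       (min_prog ;;
        slot_prog ;;
        choose_prog ;;
        DELAY\<langle>Var BEST\<rangle> ::= Minus (Var SLOT) (Cell AA (Var BEST)) ;;
        INU\<langle>Var BEST\<rangle> ::= N 0 ;;
        NU ::= Minus (Var NU) (N 1) ;;
        OCC\<langle>Var NOCC\<rangle> ::= Var SLOT ;;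
        NOCC ::= Plus (Var NOCC) (N 1))"

text \<open>
  Input encoding: \<open>\<nu>\<close> is a numbering of the vertices and \<open>es\<close> an enumeration of the arcs.
  The input size is the number of bits of all numbers in the encoding, plus one delimiter for each.
  The vertices of a star are its center and the ends of its arcs, so they need not be listed.
\<close>

definition encoding_of :: "'v pair_pre_digraph \<Rightarrow> ('v \<Rightarrow> nat) \<Rightarrow> ('v \<times> 'v) list \<Rightarrow> bool" where
  "encoding_of G \<nu> es \<longleftrightarrow> inj_on \<nu> (pverts G) \<and> distinct es \<and> set es = parcs G"

context
  fixes \<nu> :: "'v \<Rightarrow> nat" and es :: "('v \<times> 'v) list"
    and len :: "'v \<times> 'v \<Rightarrow> nat" and T :: "('v \<times> 'v) list" and x :: 'v
begin

definition input_data :: "(reg \<times> nat list) list" where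
  "input_data =
     [(CENTER, [\<nu> x]),
      (NARCS, [length es]),
      (TAIL, map (\<nu> \<circ> fst) es),
      (HEAD, map (\<nu> \<circ> snd) es),
      (LEN, map len es),
      (NDEM, [length T]),
      (SRC, map (\<nu> \<circ> fst) T),
      (DST, map (\<nu> \<circ> snd) T)]"

definition input_mem :: "reg mem" where
  "input_mem r i =
     (case map_of input_data r of
        Some ns \<Rightarrow> if i < length ns then ns ! i else 0
      | None \<Rightarrow> 0)"

definition input_size :: nat where
  "input_size = (\<Sum>(r, ns)\<leftarrow>input_data. \<Sum>n\<leftarrow>ns. bits n + 1)"

end

definition mem_represents ::
    "('v \<Rightarrow> nat) \<Rightarrow> ('v \<times> 'v) list \<Rightarrow> reg mem \<Rightarrow> 'v solution \<Rightarrow> bool" where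
  "mem_represents \<nu> T M = (\<lambda>(d, W). \<forall>i<length T.
     M DELAY i = d i \<and>
     take (M WSIZE i) [M WALK0 i, M WALK1 i, M WALK2 i] = map \<nu> (W i))"

end

theory Submission
  imports Defs
begin

text \<open>
  In an oriented star the only walk from \<open>s\<^sub>i\<close> to \<open>t\<^sub>i\<close> is \<open>W\<^sub>i\<close>, and two of these walks can meet only in
  the center. So a choice of delays is feasible iff the arrival times \<open>d\<^sub>i + a\<^sub>i\<close> at the center are
  distinct, and up to the constant \<open>\<Sum> b\<^sub>i\<close> the cost is the sum of the arrival times. An exchange
  argument shows that always filling the least usable slot minimizes this sum.

  For the program, a round costs \<open>O(k\<^sup>2)\<close> steps, because the search for a free slot passes over
  occupied slots only. That every execution yields an output of the algorithm and that every output is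
  produced by some execution are proved together, by a program logic with a demonic and an angelic
  reading of the nondeterministic choice.
\<close>

section \<open>Optimality\<close>

text \<open>Arc lengths are given in binary, so the number of steps must not depend on their values.
  The search for a free slot is the only loop not governed by a list length or by \<open>NU\<close>.
  It starts at the minimum \<open>m\<close> and not at 0, and \<open>Occ\<close> never has more than
  \<open>k\<close> elements. The exchange argument compares the algorithm with an arbitrary
  injective assignment of slots instead of an optimal one. This makes it a plain induction along the
  run, with no optimum to be modified. For the claim that every output is produced, the obstacle is
  that \<open>csa_step\<close> picks a maximiser at once, while the program settles ties pairwise
  during a scan. Fixing the wanted maximiser in advance makes the right choices local: accept it
  when the scan reaches it, refuse all ties after it.\<close>

text \<open>Each leaf has a single arc. A leaf entered from the center has therefore no outgoing
  arc, and the walk stops there.\<close>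

lemma star_walk_from_center:
  assumes "oriented_star G x" "vwalk (x # v # W) (with_proj G)"
  shows "W = []" "(x, v) \<in> parcs G" "v \<noteq> x"
proof -
  interpret pair_fin_digraph G using assms(1) by (simp add: oriented_star_def)
  show xv: "(x, v) \<in> parcs G" using assms(2) by (auto simp: vwalk_def)
  then show "v \<noteq> x" using assms(1) by (auto simp: oriented_star_def)
  then have "(v, x) \<notin> parcs G"
    using assms(1) xv in_arcsD2[OF xv] by (auto simp: oriented_star_def)
  moreover have "u = x" if "(v, u) \<in> parcs G" for u
    using that assms(1) \<open>v \<noteq> x\<close> by (auto simp: oriented_star_def)
  ultimately show "W = []" using assms(2) by (cases W) (auto simp: vwalk_def)
qed

text \<open>A leaf can only step to the center, and after the center only one more step is possible.
  The arcs are recorded because the program looks up their lengths.\<close>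

lemma star_walk:
  assumes "oriented_star G x" "walk_from_to G s W t" "s \<noteq> t"
  shows "W = (if s = x \<or> t = x then [s, t] else [s, x, t])"
    and "s \<noteq> x \<Longrightarrow> (s, x) \<in> parcs G" and "t \<noteq> x \<Longrightarrow> (x, t) \<in> parcs G"
proof -
  obtain v W' where W: "W = s # v # W'"
    using assms(2,3) by (cases W rule: vwalk_arcs.cases) (auto simp: walk_from_to_def vwalk_def)
  have walk: "vwalk (s # v # W') (with_proj G)" and last: "last (v # W') = t"
    using assms(2) W by (auto simp: walk_from_to_def)
  have "W = (if s = x \<or> t = x then [s, t] else [s, x, t]) \<and>
    (s \<noteq> x \<longrightarrow> (s, x) \<in> parcs G) \<and> (t \<noteq> x \<longrightarrow> (x, t) \<in> parcs G)"
  proof (cases "s = x")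
    case True
    then show ?thesis using star_walk_from_center[OF assms(1)] walk W last assms(3) by auto
  next
    case False
    have sv: "(s, v) \<in> parcs G" using walk by (auto simp: vwalk_def)
    then have v: "v = x" using False assms(1) by (auto simp: oriented_star_def)
    show ?thesis
    proof (cases W')
      case Nil
      then show ?thesis using False v sv W last by auto
    next
      case (Cons u W'')
      then have "vwalk (x # u # W'') (with_proj G)"
        using walk v by (auto simp: vwalk_def)
      from star_walk_from_center[OF assms(1) this] show ?thesis
        using False v sv W last Cons by auto
    qed
  qed
  then show "W = (if s = x \<or> t = x then [s, t] else [s, x, t])"
    and "s \<noteq> x \<Longrightarrow> (s, x) \<in> parcs G" and "t \<noteq> x \<Longrightarrow> (x, t) \<in> parcs G" by blast+
qed

section \<open>Feasibility and cost in terms of arrival times at the center\<close>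

locale star_instance =
  fixes G :: "'v pair_pre_digraph" and len :: "'v \<times> 'v \<Rightarrow> nat"
    and T :: "('v \<times> 'v) list" and x :: 'v
  assumes tdw: "tdw_instance G len T" and star: "oriented_star G x"
begin

abbreviation "a \<equiv> csa_a len T x"
abbreviation "b \<equiv> csa_b len T x"
abbreviation "walk \<equiv> csa_walk T x"

lemma endpoints_distinct:
  assumes "i < length T" "j < length T"
  shows "fst (T ! i) \<noteq> snd (T ! j)" and "fst (T ! i) = fst (T ! j) \<longleftrightarrow> i = j"
    and "snd (T ! i) = snd (T ! j) \<longleftrightarrow> i = j"
proof -
  have d: "distinct (map fst T)" "distinct (map snd T)" "set (map fst T) \<inter> set (map snd T) = {}"
    using tdw by (auto simp: tdw_instance_def)
  show "fst (T ! i) = fst (T ! j) \<longleftrightarrow> i = j"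
    using nth_eq_iff_index_eq[OF d(1), of i j] assms by auto
  show "snd (T ! i) = snd (T ! j) \<longleftrightarrow> i = j"
    using nth_eq_iff_index_eq[OF d(2), of i j] assms by auto
  have "fst (T ! i) \<in> set (map fst T)" "snd (T ! j) \<in> set (map snd T)"
    using assms by auto
  then show "fst (T ! i) \<noteq> snd (T ! j)" using d(3) by (metis disjoint_iff)
qed

text \<open>Uniqueness comes from \<open>star_walk\<close>. Existence is part of being an instance:
  some walk joins each demand, and it must then be \<open>walk i\<close>.\<close>

lemma
  assumes "i < length T"
  shows walk_iff: "walk_from_to G (fst (T ! i)) W (snd (T ! i)) \<longleftrightarrow> W = walk i"
    and arc_to_center: "fst (T ! i) \<noteq> x \<Longrightarrow> (fst (T ! i), x) \<in> parcs G"
    and arc_from_center: "snd (T ! i) \<noteq> x \<Longrightarrow> (x, snd (T ! i)) \<in> parcs G"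
proof -
  have "T ! i \<in> set T" using assms by simp
  then obtain W' where W': "walk_from_to G (fst (T ! i)) W' (snd (T ! i))"
    using tdw by (auto simp: tdw_instance_def split: prod.splits)
  note star = star_walk[OF star _ endpoints_distinct(1)[OF assms assms]]
  have eq: "V = walk i" if "walk_from_to G (fst (T ! i)) V (snd (T ! i))" for V
    using star(1)[OF that] by (simp add: csa_walk_def split: prod.splits)
  show "walk_from_to G (fst (T ! i)) W (snd (T ! i)) \<longleftrightarrow> W = walk i"
    using eq W' by metis
  show "fst (T ! i) \<noteq> x \<Longrightarrow> (fst (T ! i), x) \<in> parcs G" by (rule star(2)[OF W'])
  show "snd (T ! i) \<noteq> x \<Longrightarrow> (x, snd (T ! i)) \<in> parcs G" by (rule star(3)[OF W'])
qed

lemma walk_len_walk: "i < length T \<Longrightarrow> walk_len len (walk i) = a i + b i"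
  using endpoints_distinct(1)[of i i]
  by (auto simp: csa_walk_def csa_a_def csa_b_def walk_len_def walk_time_def
      split: prod.splits)

text \<open>The four ends are distinct, and each \<open>walk i\<close> visits the center exactly
  once, at offset \<open>a i\<close>. This includes demands that start or end at the center, where
  \<open>a i\<close> is 0 or the length of the whole walk.\<close>

lemma time_disjoint_iff:
  assumes "i < length T" "j < length T" "i \<noteq> j"
  shows "time_disjoint len d1 (walk i) d2 (walk j) \<longleftrightarrow> d1 + a i \<noteq> d2 + a j"
proof -
  obtain s t where i: "T ! i = (s, t)" by fastforce
  obtain s' t' where j: "T ! j = (s', t')" by fastforce
  have "s \<noteq> t" "s' \<noteq> t'" "s \<noteq> s'" "t \<noteq> t'" "s \<noteq> t'" "s' \<noteq> t"
    using endpoints_distinct[of i j] endpoints_distinct[of j i] endpoints_distinct[of i i]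
      endpoints_distinct[of j j] assms i j by auto
  then show ?thesis
    by (auto simp: time_disjoint_def csa_walk_def csa_a_def i j walk_time_def less_Suc_eq
      all_conj_distrib imp_conjL numeral_2_eq_2 numeral_3_eq_3 split: if_splits)
qed

lemma feasible_iff:
  "feasible G len T (d, W) \<longleftrightarrow>
     (\<forall>i<length T. W i = walk i) \<and> inj_on (\<lambda>i. d i + a i) {..<length T}"
proof -
  have "feasible G len T (d, W) \<longleftrightarrow> (\<forall>i<length T. W i = walk i) \<and>
      (\<forall>i<length T. \<forall>j<length T. i \<noteq> j \<longrightarrow> time_disjoint len (d i) (walk i) (d j) (walk j))"
    by (simp add: feasible_def walk_iff cong: conj_cong)
  also have "\<dots> \<longleftrightarrow> (\<forall>i<length T. W i = walk i) \<and> inj_on (\<lambda>i. d i + a i) {..<length T}"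
    by (simp add: time_disjoint_iff inj_on_def) blast
  finally show ?thesis .
qed

lemma sum_cost_eq:
  assumes "\<forall>i<length T. W i = walk i"
  shows "sum_cost len T (d, W) = (\<Sum>i<length T. d i + a i) + (\<Sum>i<length T. b i)"
  using assms by (simp add: sum_cost_def walk_len_walk add.assoc flip: sum.distrib)

text \<open>
  A competing assignment \<open>c\<close> of the remaining demands to free slots uses no slot below \<open>\<sigma>\<close>. Whichever
  demand \<open>i\<close> the algorithm puts into slot \<open>\<sigma>\<close>, a demand that has slot \<open>\<sigma>\<close> under \<open>c\<close> may move to slot
  \<open>c i\<close> instead, so the choice of \<open>i\<close> does not matter for the sum.
\<close>

lemma csa_steps_optimal:
  assumes "(csa_step len T x)\<^sup>*\<^sup>* (U, Occ, d) ({}, Occ', d')" "finite U" "finite Occ"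
  shows "(\<forall>j. j \<notin> U \<longrightarrow> d' j = d j) \<and> inj_on (\<lambda>j. d' j + a j) U \<and>
    (\<forall>j\<in>U. d' j + a j \<notin> Occ) \<and>
    (\<forall>c. inj_on c U \<and> (\<forall>j\<in>U. a j \<le> c j \<and> c j \<notin> Occ) \<longrightarrow>
       (\<Sum>j\<in>U. d' j + a j) \<le> sum c U)"
  using assms
\<comment> \<open>The first step of the run is peeled off, so the hypothesis covers all competitors
  for \<open>U - {i}\<close> and \<open>insert \<sigma> Occ\<close>.\<close>
proof (induction "(U, Occ, d)" arbitrary: U Occ d rule: converse_rtranclp_induct)
  case base
  then show ?case by simp
next
  case (step st1)
  from step.hyps(1) obtain m \<sigma> i where
    U: "U \<noteq> {}" and m: "m = Min (a ` U)" and \<sigma>: "\<sigma> = (LEAST s. m \<le> s \<and> s \<notin> Occ)"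
    and i: "i \<in> U" "a i \<le> \<sigma>"
    and st1: "st1 = (U - {i}, insert \<sigma> Occ, d(i := \<sigma> - a i))"
    by (auto elim!: csa_step.cases)
  have "finite (U - {i})" "finite (insert \<sigma> Occ)" using step.prems by auto
  note IH = step.hyps(3)[OF st1 this]
  \<comment> \<open>Since \<open>i\<close> has left the set of open demands, its delay is final;
    \<open>a i \<le> \<sigma>\<close> makes the truncated subtraction exact.\<close>
  have di: "d' i + a i = \<sigma>" using IH i(2) by auto
  have "\<exists>s. m \<le> s \<and> s \<notin> Occ"
    using ex_new_if_finite[of "Occ \<union> {..<m}"] step.prems(2) by (auto simp: not_less)
  then have free: "\<sigma> \<notin> Occ" unfolding \<sigma> using LeastI_ex by (metis (mono_tags, lifting))
  have least: "\<sigma> \<le> c" if "a j \<le> c" "c \<notin> Occ" "j \<in> U" for c j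
  proof -
    have "m \<le> a j" using m that(3) step.prems(1) by simp
    then show ?thesis using that \<sigma> by (simp add: Least_le)
  qed
  have U_eq: "U = insert i (U - {i})" using i(1) by blast
  have split: "sum f U = f i + sum f (U - {i})" for f :: "nat \<Rightarrow> nat"
    using i(1) step.prems(1) by (rule sum.remove[rotated])
  have "inj_on (\<lambda>j. d' j + a j) (insert i (U - {i}))"
    using IH di by (subst inj_on_insert) auto
  moreover have "d' j + a j \<notin> Occ" if "j \<in> U" for j
    using IH di free that by (cases "j = i") auto
  moreover have "d' j = d j" if "j \<notin> U" for j
    using IH i(1) that by (auto split: if_splits)
  moreover have "(\<Sum>j\<in>U. d' j + a j) \<le> sum c U"
    if c: "inj_on c U" "\<forall>j\<in>U. a j \<le> c j \<and> c j \<notin> Occ" for c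
  proof -
    have ge: "\<sigma> \<le> c j" if "j \<in> U" for j using least c(2) that by blast
    show ?thesis
    proof (cases "\<exists>j\<in>U - {i}. c j = \<sigma>")
      case False
      \<comment> \<open>Here \<open>c\<close> itself competes for the remaining demands, and
        \<open>\<sigma> \<le> c i\<close> pays for \<open>i\<close>.\<close>
      have "inj_on c (U - {i})" using c(1) by (rule inj_on_subset) blast
      with False c(2) IH have "(\<Sum>j\<in>U - {i}. d' j + a j) \<le> sum c (U - {i})" by auto
      then show ?thesis using split di ge[OF i(1)] by simp
    next
      case True
      then obtain j where j: "j \<in> U" "j \<noteq> i" "c j = \<sigma>" by blast
      define c' where "c' = c(j := c i)"
      have ne: "c l \<noteq> \<sigma>" if "l \<in> U" "l \<noteq> j" for l
        using c(1) j that by (auto simp: inj_on_def)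
      have "inj_on c' (U - {i})"
        using c(1) i(1) j(1) unfolding c'_def inj_on_def by auto
      \<comment> \<open>Demand \<open>j\<close> may move up because
        \<open>a j \<le> c j = \<sigma> \<le> c i\<close>.\<close>
      moreover have "\<forall>l\<in>U - {i}. a l \<le> c' l \<and> c' l \<notin> insert \<sigma> Occ"
        using c(2) i(1) j ge[OF i(1)] ne by (auto simp: c'_def intro: le_trans)
      ultimately have le: "(\<Sum>l\<in>U - {i}. d' l + a l) \<le> sum c' (U - {i})" using IH by blast
      have ji: "j \<in> U - {i}" "finite (U - {i})" using j step.prems(1) by auto
      have "sum c' (U - {i} - {j}) = sum c (U - {i} - {j})"
        by (intro sum.cong) (auto simp: c'_def)
      then have "sum c' (U - {i}) + \<sigma> = sum c U"
        using split[of c] sum.remove[OF ji(2,1), of c] sum.remove[OF ji(2,1), of c'] j(3)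
        by (simp add: c'_def)
      then show ?thesis using split di le by simp
    qed
  qed
  ultimately show ?case using U_eq by auto
qed

lemma csa_output_optimal:
  assumes "csa_output len T x S"
  shows "feasible G len T S" and "is_arg_min (sum_cost len T) (feasible G len T) S"
proof -
  obtain d Occ where S: "S = (d, walk)"
    and steps: "(csa_step len T x)\<^sup>*\<^sup>* ({..<length T}, {}, \<lambda>_. 0) ({}, Occ, d)"
    using assms by (auto simp: csa_output_def)
  note opt = csa_steps_optimal[OF steps]
  show feas: "feasible G len T S" using opt by (simp add: S feasible_iff)
  \<comment> \<open>The competitor is the family of arrival times \<open>d' i + a i\<close>, which
    meets \<open>a i \<le> c i\<close> by its form; \<open>Occ\<close> is empty at the
    start.\<close>
  have "sum_cost len T S \<le> sum_cost len T S'" if "feasible G len T S'" for S'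
  proof -
    obtain d' W' where S': "S' = (d', W')" by fastforce
    with that have "\<forall>i<length T. W' i = walk i" "inj_on (\<lambda>i. d' i + a i) {..<length T}"
      by (simp_all add: feasible_iff)
    then show ?thesis using opt by (simp add: S S' sum_cost_eq)
  qed
  then show "is_arg_min (sum_cost len T) (feasible G len T) S"
    using feas by (simp add: is_arg_min_def leD)
qed

end

section \<open>Weakest preconditions with step counts\<close>

text \<open>
  Unit cost suffices: an expression of the language at most adds up its operands, so \<open>n\<close> steps lengthen
  the numbers in memory by \<open>O(n)\<close> bits and the logarithmic cost is polynomial in \<open>n\<close> and in the
  initial bit length.
\<close>

inductive run ::
    "'r com \<Rightarrow> 'r mem \<Rightarrow> bool stream \<Rightarrow> nat \<Rightarrow> 'r mem \<Rightarrow> bool stream \<Rightarrow> bool" where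
  Skip: "run SKIP M w 1 M w"
| Store: "run (r\<langle>e\<rangle> ::= f) M w 1 (M(r := (M r)(aval e M := aval f M))) w"
| Seq: "run c1 M w t1 M1 w1 \<Longrightarrow> run c2 M1 w1 t2 M2 w2 \<Longrightarrow> run (c1 ;; c2) M w (t1 + t2) M2 w2"
| IfTrue: "bval b M \<Longrightarrow> run c1 M w t M' w' \<Longrightarrow> run (IF b THEN c1 ELSE c2) M w (Suc t) M' w'"
| IfFalse: "\<not> bval b M \<Longrightarrow> run c2 M w t M' w' \<Longrightarrow> run (IF b THEN c1 ELSE c2) M w (Suc t) M' w'"
| WhileFalse: "\<not> bval b M \<Longrightarrow> run (WHILE b DO c) M w 1 M w"
| WhileTrue: "bval b M \<Longrightarrow> run c M w t1 M1 w1 \<Longrightarrow> run (WHILE b DO c) M1 w1 t2 M2 w2 \<Longrightarrow>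
    run (WHILE b DO c) M w (Suc (t1 + t2)) M2 w2"
| FlipTrue: "run c1 M w t M' w' \<Longrightarrow> run (FLIP c1 c2) M (True ## w) (Suc t) M' w'"
| FlipFalse: "run c2 M w t M' w' \<Longrightarrow> run (FLIP c1 c2) M (False ## w) (Suc t) M' w'"

section \<open>Logarithmic cost from step counts\<close>

text \<open>One weight serves two bounds: the growth in bit length of the value and the factor in
  the cost. The 3 pays for the operation and the two bit lengths charged with it.\<close>

primrec asize :: "'r aexp \<Rightarrow> nat" where
  "asize (N n) = 1 + bits n"
| "asize (Cell r e) = asize e + 3"
| "asize (Plus e f) = asize e + asize f + 3"
| "asize (Minus e f) = asize e + asize f + 3"

primrec bsize :: "'r bexp \<Rightarrow> nat" where
  "bsize (Less e f) = asize e + asize f + 3"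
| "bsize (Equal e f) = asize e + asize f + 3"
| "bsize (Neg b) = bsize b + 1"
| "bsize (Conj b c) = bsize b + bsize c + 1"

text \<open>This is no running time but a bound on the weight of any single step. Summing over all
  subcommands makes one constant \<open>K\<close> valid for each of them.\<close>

primrec csize :: "'r com \<Rightarrow> nat" where
  "csize SKIP = 1"
| "csize (Store r e f) = asize e + asize f + 3"
| "csize (Seq c1 c2) = csize c1 + csize c2"
| "csize (Cond b c1 c2) = bsize b + 1 + csize c1 + csize c2"
| "csize (While b c) = bsize b + 1 + csize c"
| "csize (Flip c1 c2) = 1 + csize c1 + csize c2"

lemma bits_mono: "m \<le> n \<Longrightarrow> bits m \<le> bits n"
  unfolding bits_def by (rule floorlog_mono)

lemma bits_0 [simp]: "bits 0 = 0"
  by (simp add: bits_def floorlog_def)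

lemma bits_add: "bits (m + n) \<le> 1 + max (bits m) (bits n)"
proof -
  let ?k = "max (bits m) (bits n)"
  have "m < 2 ^ ?k" "n < 2 ^ ?k"
    by (auto simp: bits_def floorlog_leD)
  then have "m + n < 2 ^ (1 + ?k)" by simp
  then show ?thesis unfolding bits_def by (intro floorlog_leI) auto
qed

lemma bits_aval:
  assumes "\<And>r i. bits (M r i) \<le> L"
  shows "bits (aval e M) \<le> L + asize e"
proof (induction e)
  case (Cell r e)
  then show ?case using assms[of r "aval e M"] by simp
next
  case (Plus e f)
  then show ?case using bits_add[of "aval e M" "aval f M"] by auto
next
  case (Minus e f)
  then show ?case using bits_mono[of "aval e M - aval f M" "aval e M"] by auto
qed simp

lemma acost_le:
  assumes "\<And>r i. bits (M r i) \<le> L"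
  shows "acost e M \<le> asize e * (L + asize e)"
proof (induction e)
  case (Cell r e)
  then show ?case using assms[of r "aval e M"] bits_aval[of M L e, OF assms]
    by (simp add: algebra_simps)
next
  case (Plus e f)
  then show ?case using bits_aval[of M L e, OF assms] bits_aval[of M L f, OF assms]
    by (simp add: algebra_simps)
next
  case (Minus e f)
  then show ?case using bits_aval[of M L e, OF assms] bits_aval[of M L f, OF assms]
    by (simp add: algebra_simps)
qed simp

text \<open>The added 1 is what \<open>Cond\<close> and \<open>While\<close> charge on top of the
  test.\<close>

lemma bcost_le:
  assumes "\<And>r i. bits (M r i) \<le> L"
  shows "bcost e M + 1 \<le> (bsize e + 1) * (L + (bsize e + 1))"
proof (induction e)
  case (Less e f)
  then show ?case using bits_aval[of M L e, OF assms] bits_aval[of M L f, OF assms]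
    acost_le[of M L e, OF assms] acost_le[of M L f, OF assms]
    by (simp add: algebra_simps)
next
  case (Equal e f)
  then show ?case using bits_aval[of M L e, OF assms] bits_aval[of M L f, OF assms]
    acost_le[of M L e, OF assms] acost_le[of M L f, OF assms]
    by (simp add: algebra_simps)
qed (simp_all add: algebra_simps)

text \<open>If all numbers have at most \<open>L\<close> bits, one step costs at most
  \<open>K * (L + K)\<close> and leaves numbers of at most \<open>L + K\<close> bits. The bound on
  the cost adds up under composition because the second part starts with \<open>L + t1 * K\<close>;
  hence \<open>L\<close> is arbitrary in the induction.\<close>

lemma exec_of_run:
  assumes "run c M w n M' w'" "csize c \<le> K" "\<And>r i. bits (M r i) \<le> L"
  shows "\<exists>t. exec c M w t M' w' \<and> t \<le> n * K * (L + n * K) \<and> (\<forall>r i. bits (M' r i) \<le> L + n * K)"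
  using assms
proof (induction arbitrary: L rule: run.induct)
  case (Skip M w)
  then show ?case by (intro exI[of _ 1] conjI exec.Skip) (auto simp: trans_le_add1 )
next
  case (Store r e f M w)
  have "acost e M \<le> asize e * (L + asize e)" "acost f M \<le> asize f * (L + asize f)"
    using acost_le Store.prems(2) by metis+
  moreover have v: "bits (aval e M) \<le> L + asize e" "bits (aval f M) \<le> L + asize f"
    using bits_aval Store.prems(2) by metis+
  ultimately have "acost e M + acost f M + 1 + bits (aval e M) + bits (aval f M) \<le>
     (asize e + asize f + 3) * (L + (asize e + asize f + 3))"
    by (simp add: algebra_simps)
  also have "\<dots> \<le> K * (L + K)" using Store.prems(1) by (intro mult_mono) auto
  finally have cost: "acost e M + acost f M + 1 + bits (aval e M) + bits (aval f M) \<le> 1 * K * (L + 1 * K)"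
    by simp
  have mem: "bits ((M(r := (M r)(aval e M := aval f M))) q i) \<le> L + 1 * K" for q i
    using v(2) Store.prems(1) Store.prems(2)[of q i] by auto
  show ?case by (intro exI conjI allI, rule exec.Store, rule cost, rule mem)
next
  case (Seq c1 M w t1 M1 w1 c2 t2 M2 w2)
  from Seq.IH(1)[of L] Seq.prems obtain u1 where u1: "exec c1 M w u1 M1 w1"
    "u1 \<le> t1 * K * (L + t1 * K)" "\<forall>r i. bits (M1 r i) \<le> L + t1 * K" by auto
  from Seq.IH(2)[of "L + t1 * K"] Seq.prems u1 obtain u2 where u2: "exec c2 M1 w1 u2 M2 w2"
    "u2 \<le> t2 * K * (L + t1 * K + t2 * K)" "\<forall>r i. bits (M2 r i) \<le> L + t1 * K + t2 * K" by auto
  show ?case using u1 u2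
    by (intro exI[of _ "u1 + u2"] conjI exec.Seq[of _ _ _ _ M1 w1]) (auto simp: algebra_simps)
next
  case (IfTrue b M c1 w t M' w' c2)
  from IfTrue.IH[of L] IfTrue.prems obtain u where u: "exec c1 M w u M' w'"
    "u \<le> t * K * (L + t * K)" "\<And>r i. bits (M' r i) \<le> L + t * K" by auto
  have "bcost b M + 1 \<le> (bsize b + 1) * (L + (bsize b + 1))"
    using bcost_le IfTrue.prems(2) by metis
  also have "\<dots> \<le> K * (L + K)" using IfTrue.prems(1) by (intro mult_mono) auto
  finally have cost: "bcost b M + 1 \<le> K * (L + K)" .
  show ?case
  proof (intro exI conjI allI)
    show "exec (IF b THEN c1 ELSE c2) M w (bcost b M + 1 + u) M' w'"
      by (rule exec.IfTrue) fact+
    show "bcost b M + 1 + u \<le> Suc t * K * (L + Suc t * K)"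
      using add_le_mono[OF cost u(2)] by (simp add: algebra_simps)
    show "bits (M' r i) \<le> L + Suc t * K" for r i using u(3)[of r i] by simp
  qed
next
  case (IfFalse b M c2 w t M' w' c1)
  from IfFalse.IH[of L] IfFalse.prems obtain u where u: "exec c2 M w u M' w'"
    "u \<le> t * K * (L + t * K)" "\<And>r i. bits (M' r i) \<le> L + t * K" by auto
  have "bcost b M + 1 \<le> (bsize b + 1) * (L + (bsize b + 1))"
    using bcost_le IfFalse.prems(2) by metis
  also have "\<dots> \<le> K * (L + K)" using IfFalse.prems(1) by (intro mult_mono) auto
  finally have cost: "bcost b M + 1 \<le> K * (L + K)" .
  show ?case
  proof (intro exI conjI allI)
    show "exec (IF b THEN c1 ELSE c2) M w (bcost b M + 1 + u) M' w'"
      by (rule exec.IfFalse) fact+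
    show "bcost b M + 1 + u \<le> Suc t * K * (L + Suc t * K)"
      using add_le_mono[OF cost u(2)] by (simp add: algebra_simps)
    show "bits (M' r i) \<le> L + Suc t * K" for r i using u(3)[of r i] by simp
  qed
next
  case (WhileFalse b M c w)
  have "bcost b M + 1 \<le> (bsize b + 1) * (L + (bsize b + 1))"
    using bcost_le WhileFalse.prems(2) by metis
  also have "\<dots> \<le> K * (L + K)" using WhileFalse.prems(1) by (intro mult_mono) auto
  finally have cost: "bcost b M + 1 \<le> K * (L + K)" .
  show ?case
  proof (intro exI conjI allI)
    show "exec (WHILE b DO c) M w (bcost b M + 1) M w"
      by (rule exec.WhileFalse) fact
    show "bcost b M + 1 \<le> 1 * K * (L + 1 * K)" using cost by simp
    show "bits (M r i) \<le> L + 1 * K" for r i using WhileFalse.prems(2)[of r i] by simp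
  qed
next
  case (WhileTrue b M c w t1 M1 w1 t2 M2 w2)
  from WhileTrue.IH(1)[of L] WhileTrue.prems obtain u1 where u1: "exec c M w u1 M1 w1"
    "u1 \<le> t1 * K * (L + t1 * K)" "\<forall>r i. bits (M1 r i) \<le> L + t1 * K" by auto
  from WhileTrue.IH(2)[of "L + t1 * K"] WhileTrue.prems u1 obtain u2 where
    u2: "exec (WHILE b DO c) M1 w1 u2 M2 w2"
    "u2 \<le> t2 * K * (L + t1 * K + t2 * K)" "\<And>r i. bits (M2 r i) \<le> L + t1 * K + t2 * K" by auto
  have "bcost b M + 1 \<le> (bsize b + 1) * (L + (bsize b + 1))"
    using bcost_le WhileTrue.prems(2) by metis
  also have "\<dots> \<le> K * (L + K)" using WhileTrue.prems(1) by (intro mult_mono) auto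
  finally have cost: "bcost b M + 1 \<le> K * (L + K)" .
  show ?case
  proof (intro exI conjI allI)
    show "exec (WHILE b DO c) M w (bcost b M + 1 + u1 + u2) M2 w2"
      by (rule exec.WhileTrue) fact+
    show "bcost b M + 1 + u1 + u2 \<le> Suc (t1 + t2) * K * (L + Suc (t1 + t2) * K)"
      using cost u1(2) u2(2) by (simp add: algebra_simps)
    show "bits (M2 r i) \<le> L + Suc (t1 + t2) * K" for r i
      using u2(3)[of r i] by (simp add: algebra_simps)
  qed
next
  case (FlipTrue c1 M w t M' w' c2)
  from FlipTrue.IH[of L] FlipTrue.prems obtain u where u: "exec c1 M w u M' w'"
    "u \<le> t * K * (L + t * K)" "\<And>r i. bits (M' r i) \<le> L + t * K" by auto
  have cost: "1 \<le> K * K" using FlipTrue.prems(1) by simp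
  show ?case
  proof (intro exI conjI allI)
    show "exec (FLIP c1 c2) M (True ## w) (1 + u) M' w'"
      by (rule exec.FlipTrue) fact+
    show "1 + u \<le> Suc t * K * (L + Suc t * K)"
      using add_le_mono[OF cost u(2)] by (simp add: algebra_simps)
    show "bits (M' r i) \<le> L + Suc t * K" for r i using u(3)[of r i] by simp
  qed
next
  case (FlipFalse c2 M w t M' w' c1)
  from FlipFalse.IH[of L] FlipFalse.prems obtain u where u: "exec c2 M w u M' w'"
    "u \<le> t * K * (L + t * K)" "\<And>r i. bits (M' r i) \<le> L + t * K" by auto
  have cost: "1 \<le> K * K" using FlipFalse.prems(1) by simp
  show ?case
  proof (intro exI conjI allI)
    show "exec (FLIP c1 c2) M (False ## w) (1 + u) M' w'"
      by (rule exec.FlipFalse) fact+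
    show "1 + u \<le> Suc t * K * (L + Suc t * K)"
      using add_le_mono[OF cost u(2)] by (simp add: algebra_simps)
    show "bits (M' r i) \<le> L + Suc t * K" for r i using u(3)[of r i] by simp
  qed
qed

section \<open>Rules of the program logic\<close>

primrec writes :: "'r com \<Rightarrow> 'r set" where
  "writes SKIP = {}"
| "writes (Store r e f) = {r}"
| "writes (Seq c1 c2) = writes c1 \<union> writes c2"
| "writes (Cond b c1 c2) = writes c1 \<union> writes c2"
| "writes (While b c) = writes c"
| "writes (Flip c1 c2) = writes c1 \<union> writes c2"

lemma run_frame: "run c M w n M' w' \<Longrightarrow> r \<notin> writes c \<Longrightarrow> M' r = M r"
  by (induction rule: run.induct) auto

text \<open>
  Two readings of weakest preconditions share all rules but the one for \<^const>\<open>Flip\<close>. The demonic one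
  (\<open>angel = False\<close>) says that every choice stream leads to \<open>Q\<close>. The angelic one says that some final
  memory in \<open>Q\<close> can be reached; it is fixed before the unread bits \<open>w'\<close>, for otherwise the sequence
  rule would fail.
\<close>

definition wp :: "bool \<Rightarrow> 'r com \<Rightarrow> 'r mem \<Rightarrow> nat \<Rightarrow> ('r mem \<Rightarrow> bool) \<Rightarrow> bool" where
  "wp angel c M n Q \<longleftrightarrow>
     (if angel then \<exists>M'. Q M' \<and> (\<forall>w'. \<exists>w m. run c M w m M' w' \<and> m \<le> n)
      else \<forall>w. \<exists>m M' w'. run c M w m M' w' \<and> m \<le> n \<and> Q M')"

text \<open>The last premise hands over the frame condition as well, so that invariants of counting
  loops need not mention registers the body leaves alone.\<close>

lemma wp_mono:
  assumes "wp g c M m P" "m \<le> n"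
    "\<And>M'. P M' \<Longrightarrow> (\<And>r. r \<notin> writes c \<Longrightarrow> M' r = M r) \<Longrightarrow> Q M'"
  shows "wp g c M n Q"
proof -
  have Q: "Q M'" if "run c M w k M' w'" "P M'" for w k M' w'
    using assms(3) that run_frame by metis
  show ?thesis
  proof (cases g)
    case True
    then show ?thesis using assms(1,2) Q unfolding wp_def by simp (meson le_trans)
  next
    case False
    then show ?thesis using assms(1,2) Q unfolding wp_def by simp (meson le_trans)
  qed
qed

lemma wp_le: "wp g c M m Q \<Longrightarrow> m \<le> n \<Longrightarrow> wp g c M n Q"
  by (erule wp_mono)

lemma wp_of_run:
  assumes "\<And>w. run c M w m M' w" "m \<le> n" "Q M'"
  shows "wp g c M n Q"
  using assms unfolding wp_def by (cases g; simp) blast+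

lemma wp_map_run:
  assumes "wp g c M n Q" "\<And>w k M' w'. run c M w k M' w' \<Longrightarrow> run c' M w (Suc k) M' w'"
  shows "wp g c' M (Suc n) Q"
  using assms unfolding wp_def by (cases g; simp) (meson Suc_le_mono)+

lemma wp_cong_run:
  assumes "wp g c M n Q" "\<And>w k M' w'. run c M w k M' w' \<Longrightarrow> run c' M w k M' w'"
  shows "wp g c' M n Q"
  using assms unfolding wp_def by (cases g; simp) meson+

lemma wp_False: "\<not> wp g c M n (\<lambda>_. False)"
  unfolding wp_def by simp

lemma wp_skip: "Q M \<Longrightarrow> 1 \<le> n \<Longrightarrow> wp g SKIP M n Q"
  by (rule wp_of_run[OF run.Skip])

lemma wp_store:
  "Q (M(r := (M r)(aval e M := aval f M))) \<Longrightarrow> 1 \<le> n \<Longrightarrow> wp g (r\<langle>e\<rangle> ::= f) M n Q"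
  by (rule wp_of_run[where M' = "M(r := (M r)(aval e M := aval f M))"]) (rule run.Store)

lemma wp_seq:
  assumes "wp g c1 M n1 (\<lambda>M1. wp g c2 M1 n2 Q)"
  shows "wp g (c1 ;; c2) M (n1 + n2) Q"
proof (cases g)
  case True
  then obtain M1 where 1: "wp True c2 M1 n2 Q" "\<And>w'. \<exists>w m. run c1 M w m M1 w' \<and> m \<le> n1"
    using assms by (auto simp: wp_def)
  then obtain M2 where 2: "Q M2" "\<And>w'. \<exists>w m. run c2 M1 w m M2 w' \<and> m \<le> n2"
    by (auto simp: wp_def)
  \<comment> \<open>The stream is built backwards: the bits on which \<open>c2\<close> ends with
    rest \<open>w'\<close> are prescribed as the unread bits of \<open>c1\<close>.\<close>
  have "\<exists>w m. run (c1 ;; c2) M w m M2 w' \<and> m \<le> n1 + n2" for w'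
    using 1(2) 2(2) by (meson run.Seq add_mono)
  then show ?thesis using True 2(1) by (auto simp: wp_def)
next
  case False
  then show ?thesis using assms unfolding wp_def by simp (meson run.Seq add_mono)
qed

text \<open>The budget is counted down instead of being split into a sum, so the rule applies to any
  given \<open>n\<close>.\<close>

lemma wp_seq_store:
  assumes "wp g c (M(r := (M r)(aval e M := aval f M))) (n - 1) Q" "1 \<le> n"
  shows "wp g (r\<langle>e\<rangle> ::= f ;; c) M n Q"
proof -
  have "wp g (r\<langle>e\<rangle> ::= f ;; c) M (1 + (n - 1)) Q"
    by (rule wp_seq, rule wp_store) (use assms(1) in simp_all)
  then show ?thesis using assms(2) by simp
qed

lemma wp_if:
  assumes "bval b M \<Longrightarrow> wp g c1 M (n - 1) Q" "\<not> bval b M \<Longrightarrow> wp g c2 M (n - 1) Q" "1 \<le> n"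
  shows "wp g (IF b THEN c1 ELSE c2) M n Q"
proof -
  have "wp g (IF b THEN c1 ELSE c2) M (Suc (n - 1)) Q"
  proof (cases "bval b M")
    case True
    show ?thesis by (rule wp_map_run[OF assms(1)[OF True]]) (simp add: run.IfTrue True)
  next
    case False
    show ?thesis by (rule wp_map_run[OF assms(2)[OF False]]) (simp add: run.IfFalse False)
  qed
  then show ?thesis using assms(3) by simp
qed

text \<open>The rest of the program is copied into both branches, which avoids naming an assertion
  at the point where they meet.\<close>

lemma wp_seq_if:
  assumes "bval b M \<Longrightarrow> wp g (c1 ;; c) M (n - 1) Q" "\<not> bval b M \<Longrightarrow> wp g (c2 ;; c) M (n - 1) Q" "1 \<le> n"
  shows "wp g ((IF b THEN c1 ELSE c2) ;; c) M n Q"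
proof -
  have "wp g (IF b THEN (c1 ;; c) ELSE (c2 ;; c)) M n Q" by (rule wp_if[OF assms])
  moreover have "run ((IF b THEN c1 ELSE c2) ;; c) M w m M' w'"
    if "run (IF b THEN (c1 ;; c) ELSE (c2 ;; c)) M w m M' w'" for w m M' w'
    using that
  proof cases
    case (IfTrue t)
    from IfTrue(3) show ?thesis
    proof cases
      case (Seq t1 M1 w1 t2)
      then show ?thesis using run.Seq[OF run.IfTrue] IfTrue by fastforce
    qed
  next
    case (IfFalse t)
    from IfFalse(3) show ?thesis
    proof cases
      case (Seq t1 M1 w1 t2)
      then show ?thesis using run.Seq[OF run.IfFalse] IfFalse by fastforce
    qed
  qed
  ultimately show ?thesis by (rule wp_cong_run)
qed

lemma wp_seq_if_True:
  "bval b M \<Longrightarrow> wp g (c1 ;; c) M (n - 1) Q \<Longrightarrow> 1 \<le> n \<Longrightarrow> wp g ((IF b THEN c1 ELSE c2) ;; c) M n Q"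
  by (rule wp_seq_if; simp)

lemma wp_seq_if_False:
  "\<not> bval b M \<Longrightarrow> wp g (c2 ;; c) M (n - 1) Q \<Longrightarrow> 1 \<le> n \<Longrightarrow> wp g ((IF b THEN c1 ELSE c2) ;; c) M n Q"
  by (rule wp_seq_if; simp)

lemma wp_seq_assoc:
  assumes "wp g (c1 ;; c2 ;; c3) M n Q"
  shows "wp g ((c1 ;; c2) ;; c3) M n Q"
  using assms
proof (rule wp_cong_run)
  fix w m M' w' assume "run (c1 ;; c2 ;; c3) M w m M' w'"
  then show "run ((c1 ;; c2) ;; c3) M w m M' w'"
  proof cases
    case (Seq t1 M1 w1 t2)
    from Seq(3) show ?thesis
    proof cases
      case (Seq t3 M2 w2 t4)
      then show ?thesis
        using run.Seq[OF run.Seq] \<open>m = t1 + t2\<close> \<open>run c1 M w t1 M1 w1\<close>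
        by (fastforce simp: add.assoc)
    qed
  qed
qed

lemmas wp_intros = wp_skip wp_store wp_seq_store wp_if

text \<open>The angel puts the bit of the good branch in front of the stream, whereas the demon may
  force either branch. The sum is a crude bound for the maximum of the two step counts.\<close>

lemma wp_flip:
  assumes "\<not> g \<Longrightarrow> wp g c1 M n1 Q \<and> wp g c2 M n2 Q"
    and "g \<Longrightarrow> wp g c1 M n1 Q \<or> wp g c2 M n2 Q"
  shows "wp g (FLIP c1 c2) M (Suc (n1 + n2)) Q"
proof (cases g)
  case True
  then consider "wp True c1 M n1 Q" | "wp True c2 M n2 Q" using assms(2) by auto
  then have "wp True (FLIP c1 c2) M (Suc (n1 + n2)) Q"
  proof cases
    case 1
    then obtain M' where "Q M'" "\<And>w'. \<exists>w m. run c1 M w m M' w' \<and> m \<le> n1"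
      by (auto simp: wp_def)
    then show ?thesis unfolding wp_def
      by simp (meson run.FlipTrue Suc_le_mono trans_le_add1)
  next
    case 2
    then obtain M' where "Q M'" "\<And>w'. \<exists>w m. run c2 M w m M' w' \<and> m \<le> n2"
      by (auto simp: wp_def)
    then show ?thesis unfolding wp_def
      by simp (meson run.FlipFalse Suc_le_mono trans_le_add2)
  qed
  then show ?thesis using True by simp
next
  case False
  have "\<exists>m M' w'. run (FLIP c1 c2) M (h ## w) m M' w' \<and> m \<le> Suc (n1 + n2) \<and> Q M'" for h w
  proof (cases h)
    case True
    obtain m M' w' where "run c1 M w m M' w'" "m \<le> n1" "Q M'"
      using False assms(1) unfolding wp_def by metis
    then show ?thesis using True
      by (intro exI[of _ "Suc m"] exI conjI) (auto intro: run.FlipTrue)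
  next
    case h: False
    obtain m M' w' where "run c2 M w m M' w'" "m \<le> n2" "Q M'"
      using False assms(1) unfolding wp_def by metis
    then show ?thesis using h
      by (intro exI[of _ "Suc m"] exI conjI) (auto intro: run.FlipFalse)
  qed
  then show ?thesis using False unfolding wp_def by (metis stream.collapse)
qed

text \<open>There are at most \<open>\<mu> M\<close> rounds of one test and \<open>n\<close> steps
  each, and one failing test at the end.\<close>

lemma wp_while:
  assumes "I M"
    and body: "\<And>M. I M \<Longrightarrow> bval b M \<Longrightarrow> wp g c M n (\<lambda>M'. I M' \<and> \<mu> M' < \<mu> M)"
    and post: "\<And>M. I M \<Longrightarrow> \<not> bval b M \<Longrightarrow> Q M"
  shows "wp g (WHILE b DO c) M (Suc (\<mu> M * Suc n)) Q"
  using \<open>I M\<close>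
proof (induction "\<mu> M" arbitrary: M rule: less_induct)
  case less
  show ?case
  proof (cases "bval b M")
    case False
    then show ?thesis using post[OF less.prems]
      by (intro wp_of_run[OF run.WhileFalse]) auto
  next
    case True
    \<comment> \<open>At measure 0 the body would have to end in a memory of smaller measure, yet
      both readings guarantee that it ends.\<close>
    have \<mu>: "\<mu> M \<noteq> 0" 
    proof
      assume "\<mu> M = 0"
      with body[OF less.prems True] have "wp g c M n (\<lambda>_. False)" by simp
      then show False by (simp add: wp_False)
    qed
    have "wp g (WHILE b DO c) M' (\<mu> M * Suc n - n) Q" if "I M' \<and> \<mu> M' < \<mu> M" for M'
    proof -
      have "Suc (\<mu> M') * Suc n \<le> \<mu> M * Suc n" using that by (intro mult_right_mono) auto
      then have "Suc (\<mu> M' * Suc n) \<le> \<mu> M * Suc n - n" by simp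
      then show ?thesis using less.hyps that wp_le by blast
    qed
    then have "wp g (c ;; WHILE b DO c) M (n + (\<mu> M * Suc n - n)) Q"
      by (intro wp_seq wp_mono[OF body[OF less.prems True]] order.refl)
    then have "wp g (WHILE b DO c) M (Suc (n + (\<mu> M * Suc n - n))) Q"
      by (rule wp_map_run) (auto elim!: run.cases[of "_ ;; _"] intro: run.WhileTrue True)
    moreover have "n + (\<mu> M * Suc n - n) = \<mu> M * Suc n"
      using \<mu> by (cases "\<mu> M") auto
    ultimately show ?thesis by simp
  qed
qed

text \<open>A round costs the test, the body and the increment; the 2 is the initial store and the
  last test. \<open>I\<close> may inspect the whole memory, so the body has to establish it for the
  memory after the increment.\<close>

lemma wp_for:
  assumes "I 0 (M(i := (M i)(0 := 0)))"
    and body: "\<And>j M'. j < n \<Longrightarrow> I j M' \<Longrightarrow> M' i 0 = j \<Longrightarrow>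
       (\<And>q. q \<notin> writes c \<Longrightarrow> q \<noteq> i \<Longrightarrow> M' q = M q) \<Longrightarrow>
       wp g c M' m (\<lambda>M''. I (Suc j) (M''(i := (M'' i)(0 := Suc j))))"
    and n: "M r 0 = n" "r \<notin> writes c" "r \<noteq> i" "i \<notin> writes c"
    and post: "\<And>M'. I n M' \<Longrightarrow> M' i 0 = n \<Longrightarrow>
       (\<And>q. q \<notin> writes c \<Longrightarrow> q \<noteq> i \<Longrightarrow> M' q = M q) \<Longrightarrow> Q M'"
  shows "wp g (i\<langle>N 0\<rangle> ::= N 0 ;; WHILE Less (Cell i (N 0)) (Cell r (N 0)) DO
      (c ;; i\<langle>N 0\<rangle> ::= Plus (Cell i (N 0)) (N 1))) M (2 + n * (m + 2)) Q"
proof -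
  define J where "J M' \<longleftrightarrow> I (M' i 0) M' \<and> M' i 0 \<le> n \<and>
    (\<forall>q. q \<notin> writes c \<longrightarrow> q \<noteq> i \<longrightarrow> M' q = M q)" for M'
  have r: "M' r 0 = n" if "J M'" for M' using that n by (auto simp: J_def)
  let ?W = "WHILE Less (Cell i (N 0)) (Cell r (N 0)) DO
      (c ;; i\<langle>N 0\<rangle> ::= Plus (Cell i (N 0)) (N 1))"
  let ?M0 = "M(i := (M i)(0 := 0))"
  have "wp g ?W ?M0 (Suc ((n - ?M0 i 0) * Suc (m + 1))) Q"
  proof (rule wp_while[where I = J])
    show "J ?M0" using assms(1) by (simp add: J_def)
  next
    fix M' assume J: "J M'" "bval (Less (Cell i (N 0)) (Cell r (N 0))) M'"
    then have "M' i 0 < n" using r by auto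
    then show "wp g (c ;; i\<langle>N 0\<rangle> ::= Plus (Cell i (N 0)) (N 1)) M' (m + 1)
        (\<lambda>M''. J M'' \<and> n - M'' i 0 < n - M' i 0)"
      using J(1) n
      by (intro wp_seq wp_mono[OF body] wp_store order.refl) (auto simp: J_def)
  next
    fix M' assume "J M'" "\<not> bval (Less (Cell i (N 0)) (Cell r (N 0))) M'"
    then show "Q M'" using r[of M'] post[of M'] by (auto simp: J_def)
  qed
  then show ?thesis by (intro wp_seq_store) simp_all
qed

section \<open>The parts of the program\<close>

text \<open>The scan does not stop at the match \<open>j0\<close>, but no other entry matches, so
  \<open>LL\<close> survives from there on. Before \<open>j0\<close> nothing is claimed about
  \<open>LL\<close>. The operands are evaluated anew in each round, whence the premises on their
  stability.\<close>

lemma wp_lookup_len: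
  assumes u: "\<And>M'. (\<And>q. q \<notin> {JJ, LL} \<Longrightarrow> M' q = M q) \<Longrightarrow> aval u M' = M TAIL j0"
    and v: "\<And>M'. (\<And>q. q \<notin> {JJ, LL} \<Longrightarrow> M' q = M q) \<Longrightarrow> aval v M' = M HEAD j0"
    and j0: "j0 < n" "\<And>j. j < n \<Longrightarrow> M TAIL j = M TAIL j0 \<Longrightarrow> M HEAD j = M HEAD j0 \<Longrightarrow> j = j0"
    and n: "M NARCS 0 = n"
    and post: "\<And>M'. M' LL 0 = M LEN j0 \<Longrightarrow> (\<And>q. q \<notin> {JJ, LL} \<Longrightarrow> M' q = M q) \<Longrightarrow> Q M'"
  shows "wp g (lookup_len u v) M (2 + n * (3 + 2)) Q"
  unfolding lookup_len_def
proof (rule wp_for[where I = "\<lambda>j M'. j0 < j \<longrightarrow> M' LL 0 = M LEN j0"])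
  fix j M'
  assume j: "j < n" "j0 < j \<longrightarrow> M' LL 0 = M LEN j0" "M' JJ 0 = j" and
    frame: "\<And>q. q \<notin> writes (IF Conj (Equal (Cell TAIL (Var JJ)) u) (Equal (Cell HEAD (Var JJ)) v)
      THEN LL ::= Cell LEN (Var JJ) ELSE SKIP) \<Longrightarrow> q \<noteq> JJ \<Longrightarrow> M' q = M q"
  have fr: "M' q = M q" if "q \<notin> {JJ, LL}" for q using frame that by simp
  have uv: "aval u M' = M TAIL j0" "aval v M' = M HEAD j0"
    by (rule u v, rule fr, assumption)+
  show "wp g (IF Conj (Equal (Cell TAIL (Var JJ)) u) (Equal (Cell HEAD (Var JJ)) v)
      THEN LL ::= Cell LEN (Var JJ) ELSE SKIP) M' 3
      (\<lambda>M''. j0 < Suc j \<longrightarrow> (M''(JJ := (M'' JJ)(0 := Suc j))) LL 0 = M LEN j0)"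
    by (intro wp_intros)
      (use j j0(2)[OF j(1)] in \<open>auto simp: uv fr less_Suc_eq\<close>)
qed (use n post j0(1) in auto)

lemma wp_min_prog:
  assumes U: "U \<subseteq> {..<k}" "U \<noteq> {}" and k: "M NDEM 0 = k"
    and M: "\<And>i. i < k \<Longrightarrow> M INU i = (if i \<in> U then 1 else 0)" "\<And>i. i < k \<Longrightarrow> M AA i = f i"
    and post: "\<And>M'. M' MM 0 = Min (f ` U) \<Longrightarrow> (\<And>q. q \<notin> {FOUND, II, MM} \<Longrightarrow> M' q = M q) \<Longrightarrow> Q M'"
  shows "wp g min_prog M (1 + (2 + k * (8 + 2))) Q"
proof -
  define I where "I j M' \<longleftrightarrow> (M' FOUND 0 = 0 \<and> (\<forall>i<j. i \<notin> U) \<or>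
     M' FOUND 0 = 1 \<and> (\<exists>i\<in>U. M' MM 0 = f i) \<and> (\<forall>i<j. i \<in> U \<longrightarrow> M' MM 0 \<le> f i))"
    for j :: nat and M' :: "reg mem"
  show ?thesis unfolding min_prog_def
  proof (rule wp_seq_store, rule wp_le, rule wp_for[where I = I])
    fix j M'
    let ?c = "IF Equal (Cell INU (Var II)) (N 1) THEN
          (IF Equal (Var FOUND) (N 0) THEN
             (MM ::= Cell AA (Var II) ;; FOUND ::= N 1)
           ELSE IF Less (Cell AA (Var II)) (Var MM) THEN
             MM ::= Cell AA (Var II)
           ELSE SKIP)
        ELSE SKIP"
    let ?M = "M(FOUND := (M FOUND)(aval (N 0) M := aval (N 0) M))"
    assume j: "j < k" "I j M'" "M' II 0 = j"
      and frame: "\<And>q. q \<notin> writes ?c \<Longrightarrow> q \<noteq> II \<Longrightarrow> M' q = ?M q"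
    have fr: "M' q = M q" if "q \<notin> {FOUND, II, MM}" for q using frame that by simp
    have mem: "M' II 0 = j" "M' INU j = (if j \<in> U then 1 else 0)" "M' AA j = f j"
      using fr M j(1,3) by simp_all
    consider (none) "M' FOUND 0 = 0" "\<forall>i<j. i \<notin> U"
      | (some) i where "M' FOUND 0 = 1" "i \<in> U" "M' MM 0 = f i" "\<forall>i'<j. i' \<in> U \<longrightarrow> f i \<le> f i'"
      using j(2) unfolding I_def by auto
    then show "wp g ?c M' 8 (\<lambda>M''. I (Suc j) (M''(II := (M'' II)(0 := Suc j))))"
    proof cases
      case none
      then show ?thesis
        by (intro wp_intros) (auto simp: mem I_def less_Suc_eq split: if_splits)
    next
      case (some i)
      let ?P = "\<lambda>M''. I (Suc j) (M''(II := (M'' II)(0 := Suc j)))"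
      have new: "?P (M'(MM := (M' MM)(0 := f j)))" if "j \<in> U" "f j < f i"
        using that some by (fastforce simp: I_def less_Suc_eq)
      have old: "?P M'" if "j \<in> U \<longrightarrow> f i \<le> f j"
        using that some by (fastforce simp: I_def less_Suc_eq)
      consider "j \<in> U" "f j < f i" | "j \<in> U" "f i \<le> f j" | "j \<notin> U" by linarith
      then show ?thesis
      proof cases
        case 1
        then show ?thesis using some(1,3) new by (intro wp_intros) (simp_all add: mem)
      next
        case 2
        then show ?thesis using some(1,3) old by (intro wp_intros) (simp_all add: mem)
      next
        case 3
        then show ?thesis using some(1,3) old by (intro wp_intros) (simp_all add: mem)
      qed
    qed
  next
    fix M' :: "reg mem"
    let ?c = "IF Equal (Cell INU (Var II)) (N 1) THEN
          (IF Equal (Var FOUND) (N 0) THEN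
             (MM ::= Cell AA (Var II) ;; FOUND ::= N 1)
           ELSE IF Less (Cell AA (Var II)) (Var MM) THEN
             MM ::= Cell AA (Var II)
           ELSE SKIP)
        ELSE SKIP"
    let ?M = "M(FOUND := (M FOUND)(aval (N 0) M := aval (N 0) M))"
    assume I: "I k M'" and frame: "\<And>q. q \<notin> writes ?c \<Longrightarrow> q \<noteq> II \<Longrightarrow> M' q = ?M q"
    have "finite U" using U(1) finite_subset by blast
    moreover have "M' MM 0 \<in> f ` U" "\<forall>i\<in>U. M' MM 0 \<le> f i" using I U by (auto simp: I_def)
    ultimately have "M' MM 0 = Min (f ` U)" by (intro Min_eqI[symmetric]) auto
    then show "Q M'" by (rule post) (use frame in simp)
  qed (use k in \<open>simp_all add: I_def\<close>)
qed

text \<open>All slots from \<open>m\<close> up to the current one lie in a set of at most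
  \<open>q\<close> elements. So there are at most \<open>q + 1\<close> rounds, each a scan of the
  \<open>q\<close> stored slots, however large the numbers are.\<close>

lemma wp_slot_prog:
  assumes q: "M NOCC 0 = q" and Occ: "Occ = M OCC ` {..<q}"
    and post: "\<And>M'. M' SLOT 0 = (LEAST s. M MM 0 \<le> s \<and> s \<notin> Occ) \<Longrightarrow>
      (\<And>r. r \<notin> {SLOT, FOUND, JJ} \<Longrightarrow> M' r = M r) \<Longrightarrow> Q M'"
  shows "wp g slot_prog M (3 + (q + 1) * (7 + 5 * q)) Q"
proof -
  define m where "m = M MM 0"
  define I where "I M' \<longleftrightarrow> (\<forall>r. r \<notin> {SLOT, FOUND, JJ} \<longrightarrow> M' r = M r) \<and>
     m \<le> M' SLOT 0 \<and> {m..<M' SLOT 0} \<subseteq> Occ \<and>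
     (M' FOUND 0 = 0 \<and> M' SLOT 0 \<notin> Occ \<or> M' FOUND 0 = 1)" for M' :: "reg mem"
  \<comment> \<open>The \<open>Suc\<close> keeps the measure positive while \<open>FOUND\<close> is
    set, so that clearing it counts as progress even at slot \<open>q + m\<close>.\<close>
  define \<mu> where "\<mu> M' = (if M' FOUND 0 = 0 then 0 else Suc (q + m - M' SLOT 0))" for M' :: "reg mem"
  let ?b = "Equal (Var FOUND) (N 1)"
  let ?if1 = "IF Equal (Cell OCC (Var JJ)) (Var SLOT) THEN FOUND ::= N 1 ELSE SKIP"
  let ?if2 = "IF Equal (Var FOUND) (N 1) THEN SLOT ::= Plus (Var SLOT) (N 1) ELSE SKIP"
  let ?body = "FOUND ::= N 0 ;; (FOR JJ < Var NOCC DO ?if1) ;; ?if2"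
  have slot_le: "s \<le> q + m" if "{m..<s} \<subseteq> Occ" for s
  proof -
    have "card {m..<s} \<le> card Occ" using that by (intro card_mono) (auto simp: Occ)
    also have "card Occ \<le> q" unfolding Occ using card_image_le[of "{..<q}"] by simp
    finally show ?thesis by simp
  qed
  have body: "wp g ?body M1 (6 + 5 * q) (\<lambda>M2. I M2 \<and> \<mu> M2 < \<mu> M1)"
    if I: "I M1" and b: "bval ?b M1" for M1
  proof -
    define J where "J j M' \<longleftrightarrow> M' FOUND 0 = (if \<exists>i<j. M OCC i = M1 SLOT 0 then 1 else 0)"
      for j :: nat and M' :: "reg mem"
    have if2: "wp g ?if2 M' 3 (\<lambda>M2. I M2 \<and> \<mu> M2 < \<mu> M1)"
      if J: "J q M'" and fr: "\<And>r. r \<notin> {FOUND, JJ} \<Longrightarrow> M' r = M1 r" for M'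
    proof -
      have found: "M' FOUND 0 = (if M1 SLOT 0 \<in> Occ then 1 else 0)" using J
        by (force simp: J_def Occ image_iff)
      have ins: "{m..<Suc (M1 SLOT 0)} \<subseteq> Occ" if "M1 SLOT 0 \<in> Occ"
        using I that by (auto simp: I_def less_Suc_eq)
      define s where "s = M1 SLOT 0"
      have mem: "M' SLOT 0 = s" "M1 SLOT 0 = s" "M1 FOUND 0 = 1"
        "M' FOUND 0 = (if s \<in> Occ then 1 else 0)"
        using fr b found by (simp_all add: s_def)
      have frame: "M' r = M r" if "r \<notin> {SLOT, FOUND, JJ}" for r
        using fr[of r] I that by (simp add: I_def)
      have s: "m \<le> s" "{m..<s} \<subseteq> Occ" using I by (auto simp: I_def s_def)
      \<comment> \<open>Counting the interval that includes the occupied slot \<open>s\<close> gives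
        a strict bound, hence a strict decrease of the measure.\<close>
      have next_slot: "{m..<Suc s} \<subseteq> Occ" "s < q + m" if "s \<in> Occ"
        using ins slot_le[OF ins] that unfolding s_def by simp_all
      show ?thesis
      proof (cases "s \<in> Occ")
        case True
        show ?thesis
          by (intro wp_intros)
            (use True s next_slot[OF True] in \<open>simp_all add: mem frame I_def \<mu>_def\<close>)
      next
        case False
        show ?thesis
          by (intro wp_intros) (use False s in \<open>simp_all add: mem frame I_def \<mu>_def\<close>)
      qed
    qed
    have for_loop: "wp g (FOR JJ < Var NOCC DO ?if1) M' (2 + q * (3 + 2))
       (\<lambda>M2. wp g ?if2 M2 3 (\<lambda>M2. I M2 \<and> \<mu> M2 < \<mu> M1))"
      if 0: "M' FOUND 0 = 0" and fr: "\<And>r. r \<noteq> FOUND \<Longrightarrow> M' r = M1 r" for M'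
    proof (rule wp_for[where I = J])
      fix j M2
      assume j: "j < q" "J j M2" "M2 JJ 0 = j"
        and frame: "\<And>r. r \<notin> writes ?if1 \<Longrightarrow> r \<noteq> JJ \<Longrightarrow> M2 r = M' r"
      have "M2 OCC = M OCC" "M2 SLOT = M1 SLOT" using frame fr I by (auto simp: I_def)
      then show "wp g ?if1 M2 3 (\<lambda>M3. J (Suc j) (M3(JJ := (M3 JJ)(0 := Suc j))))"
        by (intro wp_intros)
          (use j in \<open>auto simp: J_def less_Suc_eq split: if_splits\<close>)
    next
      fix M2
      assume "J q M2" and frame: "\<And>r. r \<notin> writes ?if1 \<Longrightarrow> r \<noteq> JJ \<Longrightarrow> M2 r = M' r"
      then show "wp g ?if2 M2 3 (\<lambda>M2. I M2 \<and> \<mu> M2 < \<mu> M1)"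
        by (intro if2) (use fr in auto)
    qed (use 0 fr I q in \<open>auto simp: J_def I_def\<close>)
    show ?thesis
      by (rule wp_seq_store, rule wp_le, rule wp_seq, rule for_loop) auto
  qed
  have while: "wp g (WHILE ?b DO ?body) M' (Suc (Suc q * Suc (6 + 5 * q))) Q"
    if "I M'" "M' SLOT 0 = m" "M' FOUND 0 = 1" for M'
  proof -
    have "wp g (WHILE ?b DO ?body) M' (Suc (\<mu> M' * Suc (6 + 5 * q))) Q"
    proof (rule wp_while[where I = I], fact, rule body)
      fix M2 assume "I M2" and "\<not> bval ?b M2"
      then have I: "I M2" "M2 FOUND 0 = 0" by (auto simp: I_def)
      have "(LEAST s. M MM 0 \<le> s \<and> s \<notin> Occ) = M2 SLOT 0"
        using I by (intro Least_equality) (auto simp: I_def m_def not_less[symmetric] subset_iff)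
      then show "Q M2" using I by (intro post) (auto simp: I_def)
    qed
    then show ?thesis using that by (simp add: \<mu>_def)
  qed
  show ?thesis unfolding slot_prog_def
    by (rule wp_seq_store, rule wp_seq_store, rule wp_le, rule while)
      (auto simp: I_def m_def)
qed

text \<open>The angel aims at a given maximiser \<open>i0\<close>, and the invariant says that
  \<open>BEST\<close> is \<open>i0\<close> once the scan has passed it. On arrival at
  \<open>i0\<close> the current best is absent, strictly worse or tied, and a tie is accepted; later
  candidates are never strictly better, and ties with them are refused.\<close>

lemma wp_choose_prog:
  assumes U: "U \<subseteq> {..<k}" and k: "M NDEM 0 = k"
    and M: "\<And>i. i < k \<Longrightarrow> M INU i = (if i \<in> U then 1 else 0)"
      "\<And>i. i < k \<Longrightarrow> M AA i = f i" "\<And>i. i < k \<Longrightarrow> M BB i = h i"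
    and ex: "\<exists>i\<in>U. f i \<le> M SLOT 0"
    and target: "g \<Longrightarrow> i0 \<in> U \<and> f i0 \<le> M SLOT 0 \<and> (\<forall>j\<in>U. f j \<le> M SLOT 0 \<longrightarrow> h j \<le> h i0)"
    and post: "\<And>M' i. M' BEST 0 = i \<Longrightarrow> i \<in> U \<Longrightarrow> f i \<le> M SLOT 0 \<Longrightarrow>
      \<forall>j\<in>U. f j \<le> M SLOT 0 \<longrightarrow> h j \<le> h i \<Longrightarrow> (g \<Longrightarrow> i = i0) \<Longrightarrow>
      (\<And>q. q \<notin> {FOUND, II, BEST} \<Longrightarrow> M' q = M q) \<Longrightarrow> Q M'"
  shows "wp g choose_prog M (1 + (2 + k * (12 + 2))) Q"
proof -
  define E where "E = {i \<in> U. f i \<le> M SLOT 0}"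
  define I where "I j M' \<longleftrightarrow> (M' FOUND 0 = 0 \<and> (\<forall>i<j. i \<notin> E) \<or>
     M' FOUND 0 = 1 \<and> M' BEST 0 \<in> E \<and> M' BEST 0 < j \<and> (\<forall>i<j. i \<in> E \<longrightarrow> h i \<le> h (M' BEST 0)) \<and>
       (g \<longrightarrow> i0 < j \<longrightarrow> M' BEST 0 = i0))"
    for j :: nat and M' :: "reg mem"
  have target': "i0 \<in> E \<and> (\<forall>j\<in>E. h j \<le> h i0)" if g
    using target[OF that] by (auto simp: E_def)
  let ?flip = "FLIP (BEST ::= Var II) SKIP"
  let ?c = "IF Conj (Equal (Cell INU (Var II)) (N 1)) (Neg (Less (Var SLOT) (Cell AA (Var II)))) THEN
          (IF Equal (Var FOUND) (N 0) THEN
             (BEST ::= Var II ;; FOUND ::= N 1)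
           ELSE IF Less (Cell BB (Var BEST)) (Cell BB (Var II)) THEN
             BEST ::= Var II
           ELSE IF Equal (Cell BB (Var BEST)) (Cell BB (Var II)) THEN
             ?flip
           ELSE SKIP)
        ELSE SKIP"
  let ?M = "M(FOUND := (M FOUND)(aval (N 0) M := aval (N 0) M))"
  show ?thesis unfolding choose_prog_def
  proof (rule wp_seq_store, rule wp_le, rule wp_for[where I = I])
    fix j M'
    assume j: "j < k" "I j M'" "M' II 0 = j"
      and frame: "\<And>q. q \<notin> writes ?c \<Longrightarrow> q \<noteq> II \<Longrightarrow> M' q = ?M q"
    have fr: "M' q = M q" if "q \<notin> {FOUND, II, BEST}" for q using frame that by simp
    have mem: "M' INU j = (if j \<in> U then 1 else 0)" "M' AA j = f j" "M' SLOT = M SLOT"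
      using fr M j(1) by simp_all
    have BB: "M' BB i = h i" if "i < k" for i using fr M that by simp
    have flip: "wp g ?flip M' 3 (\<lambda>M''. I (Suc j) (M''(II := (M'' II)(0 := Suc j))))"
      if "j \<in> E" "M' FOUND 0 \<noteq> 0" "h (M' BEST 0) = h j"
    proof -
      let ?P = "\<lambda>M''. I (Suc j) (M''(II := (M'' II)(0 := Suc j)))"
      \<comment> \<open>For the demon both premises are vacuous, so both branches are covered. For
        the angel exactly one of them holds.\<close>
      have 1: "wp g (BEST ::= Var II) M' 1 ?P" if "g \<Longrightarrow> j = i0"
        by (rule wp_store)
          (use that \<open>j \<in> E\<close> \<open>M' FOUND 0 \<noteq> 0\<close> \<open>h (M' BEST 0) = h j\<close> j in \<open>auto simp: I_def less_Suc_eq\<close>)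
      have 2: "wp g SKIP M' 1 ?P" if "g \<Longrightarrow> j \<noteq> i0"
        by (rule wp_skip)
          (use that \<open>j \<in> E\<close> \<open>M' FOUND 0 \<noteq> 0\<close> \<open>h (M' BEST 0) = h j\<close> j in \<open>auto simp: I_def less_Suc_eq\<close>)
      show ?thesis by (rule wp_le, rule wp_flip) (use 1 2 in auto)
    qed
    show "wp g ?c M' 12 (\<lambda>M''. I (Suc j) (M''(II := (M'' II)(0 := Suc j))))"
    proof (cases "j \<in> E")
      case False
      then have "\<not> bval (Conj (Equal (Cell INU (Var II)) (N 1)) (Neg (Less (Var SLOT) (Cell AA (Var II))))) M'"
        using mem j by (auto simp: E_def)
      then show ?thesis
        by (intro wp_if wp_skip)
          (use False j target' in \<open>auto simp: I_def less_Suc_eq\<close>)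
    next
      case True
      have bv: "bval (Conj (Equal (Cell INU (Var II)) (N 1)) (Neg (Less (Var SLOT) (Cell AA (Var II))))) M'"
        using True mem j(3) by (simp add: E_def)
      show ?thesis
      proof (cases "M' FOUND 0 = 0")
        case none: True
        have "\<not> i0 < j" if g using none j(2) target'[OF that] by (auto simp: I_def)
        then show ?thesis
          by (intro wp_if wp_seq_store wp_store wp_skip)
            (use bv none j(2) True in \<open>simp_all add: I_def j(3) less_Suc_eq\<close>)
      next
        case False
        define \<beta> where "\<beta> = M' BEST 0"
        have \<beta>: "M' FOUND 0 = 1" "\<beta> \<in> E" "\<beta> < j" "\<forall>i<j. i \<in> E \<longrightarrow> h i \<le> h \<beta>"
          "g \<longrightarrow> i0 < j \<longrightarrow> \<beta> = i0"
          using False j(2) by (simp_all add: I_def \<beta>_def)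
        have t: "h j \<le> h i0" "h \<beta> \<le> h i0" if g using target'[OF that] True \<beta>(2) by auto
        have vals: "M' BEST 0 = \<beta>" "M' BB \<beta> = h \<beta>" "M' BB j = h j"
          using BB \<beta>(3) j(1) by (simp_all add: \<beta>_def)
        let ?P = "\<lambda>M''. I (Suc j) (M''(II := (M'' II)(0 := Suc j)))"
        \<comment> \<open>Had \<open>i0\<close> been passed, \<open>\<beta>\<close> would be
          \<open>i0\<close> and could not be beaten.\<close>
        have better: "?P (M'(BEST := (M' BEST)(0 := j)))" if "h \<beta> < h j"
          using that True \<beta> t by (fastforce simp: I_def less_Suc_eq)
        have worse: "?P M'" if "h j < h \<beta>"
          using that True \<beta> t vals by (fastforce simp: I_def less_Suc_eq)
        consider "h \<beta> < h j" | "h \<beta> = h j" | "h j < h \<beta>" by linarith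
        then show ?thesis
        proof cases
          case 1
          show ?thesis
            by (intro wp_if wp_seq_store wp_store wp_skip)
              (use bv False 1 better in \<open>simp_all add: vals j(3)\<close>)
        next
          case 2
          show ?thesis
            by (intro wp_if wp_seq_store wp_store wp_skip wp_le[OF flip])
              (use bv False 2 True in \<open>simp_all add: vals j(3)\<close>)
        next
          case 3
          show ?thesis
            by (intro wp_if wp_seq_store wp_store wp_skip)
              (use bv False 3 worse in \<open>simp_all add: vals j(3)\<close>)
        qed
      qed
    qed
  next
    fix M'
    assume I: "I k M'" and frame: "\<And>q. q \<notin> writes ?c \<Longrightarrow> q \<noteq> II \<Longrightarrow> M' q = ?M q"
    have "E \<subseteq> {..<k}" using U by (auto simp: E_def)
    moreover have "E \<noteq> {}" using ex by (auto simp: E_def)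
    ultimately have "M' BEST 0 \<in> E" "\<forall>i\<in>E. h i \<le> h (M' BEST 0)" "g \<Longrightarrow> M' BEST 0 = i0"
      using I target' by (auto simp: I_def)
    then show "Q M'" by (intro post[OF refl]) (use frame in \<open>auto simp: E_def\<close>)
  qed (use k in \<open>simp_all add: I_def\<close>)
qed

section \<open>Loop bodies as separate commands, and the bounding polynomials\<close>

definition csa_round :: "reg com" where
  "csa_round =
     min_prog ;;
     slot_prog ;;
     choose_prog ;;
     DELAY\<langle>Var BEST\<rangle> ::= Minus (Var SLOT) (Cell AA (Var BEST)) ;;
     INU\<langle>Var BEST\<rangle> ::= N 0 ;;
     NU ::= Minus (Var NU) (N 1) ;;
     OCC\<langle>Var NOCC\<rangle> ::= Var SLOT ;;
     NOCC ::= Plus (Var NOCC) (N 1)"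

lemma csa_prog_eq: "csa_prog = init_prog ;; WHILE Less (N 0) (Var NU) DO csa_round"
  by (simp add: csa_prog_def csa_round_def)

definition init_demand :: "reg com" where
  "init_demand =
     (IF Equal (Cell SRC (Var II)) (Var CENTER) THEN
         (AA\<langle>Var II\<rangle> ::= N 0 ;;
          lookup_len (Var CENTER) (Cell DST (Var II)) ;;
          BB\<langle>Var II\<rangle> ::= Var LL ;;
          WSIZE\<langle>Var II\<rangle> ::= N 2 ;;
          WALK0\<langle>Var II\<rangle> ::= Cell SRC (Var II) ;;
          WALK1\<langle>Var II\<rangle> ::= Cell DST (Var II))
       ELSE IF Equal (Cell DST (Var II)) (Var CENTER) THEN
         (lookup_len (Cell SRC (Var II)) (Var CENTER) ;;
          AA\<langle>Var II\<rangle> ::= Var LL ;;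
          BB\<langle>Var II\<rangle> ::= N 0 ;;
          WSIZE\<langle>Var II\<rangle> ::= N 2 ;;
          WALK0\<langle>Var II\<rangle> ::= Cell SRC (Var II) ;;
          WALK1\<langle>Var II\<rangle> ::= Cell DST (Var II))
       ELSE
         (lookup_len (Cell SRC (Var II)) (Var CENTER) ;;
          AA\<langle>Var II\<rangle> ::= Var LL ;;
          lookup_len (Var CENTER) (Cell DST (Var II)) ;;
          BB\<langle>Var II\<rangle> ::= Var LL ;;
          WSIZE\<langle>Var II\<rangle> ::= N 3 ;;
          WALK0\<langle>Var II\<rangle> ::= Cell SRC (Var II) ;;
          WALK1\<langle>Var II\<rangle> ::= Var CENTER ;;
          WALK2\<langle>Var II\<rangle> ::= Cell DST (Var II))) ;;
      INU\<langle>Var II\<rangle> ::= N 1"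

lemma init_prog_eq:
  "init_prog = (FOR II < Var NDEM DO init_demand) ;; NU ::= Var NDEM ;; NOCC ::= N 0"
  by (simp add: init_prog_def init_demand_def)

lemma writes_init_demand:
  "writes init_demand = {AA, BB, WSIZE, WALK0, WALK1, WALK2, INU, JJ, LL}"
  by (auto simp: init_demand_def lookup_len_def)

text \<open>Replacing both \<open>k\<close> and the number of arcs by the input size
  \<open>N\<close> in \<open>prog_time\<close> gives \<open>5 + 37 N + 46 N^2 + 5 N^3\<close>, which
  these coefficients dominate.\<close>

definition step_poly :: "nat poly" where
  "step_poly = [:5, 51, 56, 5:]"

text \<open>The bound of \<open>exec_of_run\<close> with the input size, here
  \<open>[:0, 1:]\<close>, for \<open>L\<close>. The factor \<open>csize csa_prog\<close> belongs to
  the fixed program, so one polynomial serves all instances.\<close>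

definition time_poly :: "nat poly" where
  "time_poly = (let q = smult (csize csa_prog) step_poly in q * ([:0, 1:] + q))"

section \<open>The program on an encoded instance\<close>

locale encoded_star_instance = star_instance +
  fixes \<nu> :: "'a \<Rightarrow> nat" and es :: "('a \<times> 'a) list"
  assumes enc: "encoding_of G \<nu> es"
begin

abbreviation "M0 \<equiv> input_mem \<nu> es len T x"
abbreviation "k \<equiv> length T"

lemma input_mem_simps:
  "M0 CENTER 0 = \<nu> x" "M0 NARCS 0 = length es" "M0 NDEM 0 = k"
  "j < length es \<Longrightarrow> M0 TAIL j = \<nu> (fst (es ! j))"
  "j < length es \<Longrightarrow> M0 HEAD j = \<nu> (snd (es ! j))"
  "j < length es \<Longrightarrow> M0 LEN j = len (es ! j)"
  "i < k \<Longrightarrow> M0 SRC i = \<nu> (fst (T ! i))" "i < k \<Longrightarrow> M0 DST i = \<nu> (snd (T ! i))"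
  by (simp_all add: input_mem_def input_data_def)

lemma verts:
  "x \<in> pverts G" "i < k \<Longrightarrow> fst (T ! i) \<in> pverts G" "i < k \<Longrightarrow> snd (T ! i) \<in> pverts G"
  "e \<in> parcs G \<Longrightarrow> fst e \<in> pverts G" "e \<in> parcs G \<Longrightarrow> snd e \<in> pverts G"
proof -
  interpret pair_fin_digraph G using tdw by (simp add: tdw_instance_def)
  show "e \<in> parcs G \<Longrightarrow> fst e \<in> pverts G" "e \<in> parcs G \<Longrightarrow> snd e \<in> pverts G"
    by (rule arc_fst_in_verts arc_snd_in_verts, assumption)+
  have "T ! i \<in> pverts G \<times> pverts G" if "i < k"
    using tdw that nth_mem by (fastforce simp: tdw_instance_def)
  then show "i < k \<Longrightarrow> fst (T ! i) \<in> pverts G" "i < k \<Longrightarrow> snd (T ! i) \<in> pverts G"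
    by (auto simp: mem_Times_iff)
qed (use star in \<open>simp add: oriented_star_def\<close>)

lemma code_eq_iff: "u \<in> pverts G \<Longrightarrow> v \<in> pverts G \<Longrightarrow> \<nu> u = \<nu> v \<longleftrightarrow> u = v"
  using enc by (auto simp: encoding_of_def inj_on_def)

definition inputs_kept :: "reg mem \<Rightarrow> bool" where
  "inputs_kept M \<longleftrightarrow> (\<forall>r\<in>{CENTER, NARCS, TAIL, HEAD, LEN, NDEM, SRC, DST}. M r = M0 r)"

abbreviation "lookup_time \<equiv> 2 + length es * (3 + 2)"

text \<open>Codes are injective on vertices and \<open>es\<close> lists each arc once, so a pair of
  codes matches a single index.\<close>

lemma wp_lookup_arc:
  assumes arc: "(s, t) \<in> parcs G" and M: "inputs_kept M"
    and u: "\<And>M'. (\<And>q. q \<notin> {JJ, LL} \<Longrightarrow> M' q = M q) \<Longrightarrow> aval u M' = \<nu> s"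
    and v: "\<And>M'. (\<And>q. q \<notin> {JJ, LL} \<Longrightarrow> M' q = M q) \<Longrightarrow> aval v M' = \<nu> t"
    and post: "\<And>M'. M' LL 0 = len (s, t) \<Longrightarrow> (\<And>q. q \<notin> {JJ, LL} \<Longrightarrow> M' q = M q) \<Longrightarrow> Q M'"
  shows "wp g (lookup_len u v) M lookup_time Q"
proof -
  obtain j0 where j0: "j0 < length es" "es ! j0 = (s, t)"
    using arc enc unfolding encoding_of_def by (metis in_set_conv_nth)
  have code: "M TAIL j = \<nu> (fst (es ! j))" "M HEAD j = \<nu> (snd (es ! j))" "M LEN j = len (es ! j)"
    if "j < length es" for j
    using M that by (simp_all add: inputs_kept_def input_mem_simps)
  have uniq: "j = j0" if "j < length es" "M TAIL j = M TAIL j0" "M HEAD j = M HEAD j0" for j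
  proof -
    have "es ! j \<in> parcs G" "es ! j0 \<in> parcs G"
      using that(1) j0(1) enc nth_mem by (auto simp: encoding_of_def)
    then have "es ! j = es ! j0"
      using that code j0(1) code_eq_iff verts by (simp add: prod_eq_iff)
    then show ?thesis
      using enc that(1) j0(1) by (simp add: encoding_of_def nth_eq_iff_index_eq)
  qed
  note code0 = code[OF j0(1), unfolded j0(2) fst_conv snd_conv]
  show ?thesis
  proof (rule wp_lookup_len[where ?j0.0 = j0, OF _ _ j0(1) uniq])
    fix M' assume fr: "\<And>q. q \<notin> {JJ, LL} \<Longrightarrow> M' q = M q"
    show "aval u M' = M TAIL j0" unfolding code0 by (rule u[OF fr])
    show "aval v M' = M HEAD j0" unfolding code0 by (rule v[OF fr])
    show "M' LL 0 = M LEN j0 \<Longrightarrow> Q M'" unfolding code0 by (rule post[OF _ fr])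
  next
    show "M NARCS 0 = length es" using M by (simp add: inputs_kept_def input_mem_simps)
  qed
qed

lemma wp_lookup_a:
  assumes "i < k" "fst (T ! i) \<noteq> x" "M II 0 = i" "inputs_kept M"
    and "\<And>M'. M' LL 0 = a i \<Longrightarrow> (\<And>q. q \<notin> {JJ, LL} \<Longrightarrow> M' q = M q) \<Longrightarrow>
       wp g c M' (n - lookup_time) Q" "lookup_time \<le> n"
  shows "wp g (lookup_len (Cell SRC (Var II)) (Var CENTER) ;; c) M n Q"
proof (rule wp_le, rule wp_seq, rule wp_lookup_arc[OF arc_to_center[OF assms(1,2)] assms(4)])
  fix M' assume LL: "M' LL 0 = len (fst (T ! i), x)" and fr: "\<And>q. q \<notin> {JJ, LL} \<Longrightarrow> M' q = M q"
  show "wp g c M' (n - lookup_time) Q"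
  proof (rule assms(5))
    show "M' LL 0 = a i" using LL assms(2) by (simp add: csa_a_def split_beta)
  qed (rule fr)
qed (use assms(1,3,4,6) in \<open>simp_all add: inputs_kept_def input_mem_simps\<close>)

lemma wp_lookup_b:
  assumes "i < k" "snd (T ! i) \<noteq> x" "M II 0 = i" "inputs_kept M"
    and "\<And>M'. M' LL 0 = b i \<Longrightarrow> (\<And>q. q \<notin> {JJ, LL} \<Longrightarrow> M' q = M q) \<Longrightarrow>
       wp g c M' (n - lookup_time) Q" "lookup_time \<le> n"
  shows "wp g (lookup_len (Var CENTER) (Cell DST (Var II)) ;; c) M n Q"
proof (rule wp_le, rule wp_seq, rule wp_lookup_arc[OF arc_from_center[OF assms(1,2)] assms(4)])
  fix M' assume LL: "M' LL 0 = len (x, snd (T ! i))" and fr: "\<And>q. q \<notin> {JJ, LL} \<Longrightarrow> M' q = M q"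
  show "wp g c M' (n - lookup_time) Q"
  proof (rule assms(5))
    show "M' LL 0 = b i" using LL assms(2) by (simp add: csa_b_def split_beta)
  qed (rule fr)
qed (use assms(1,3,4,6) in \<open>simp_all add: inputs_kept_def input_mem_simps\<close>)

definition walk_stored :: "reg mem \<Rightarrow> nat \<Rightarrow> bool" where
  "walk_stored M i \<longleftrightarrow> take (M WSIZE i) [M WALK0 i, M WALK1 i, M WALK2 i] = map \<nu> (walk i)"

definition demand_stored :: "reg mem \<Rightarrow> nat \<Rightarrow> bool" where
  "demand_stored M i \<longleftrightarrow> M AA i = a i \<and> M BB i = b i \<and> walk_stored M i"

text \<open>The coupling between memory and abstract state. Delays are compared only for demands
  already served, whose values are final. \<open>M NOCC 0 + card U = k\<close> bounds the list of
  occupied slots, and with it the slot search, by \<open>k\<close>.\<close>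

definition represents :: "reg mem \<Rightarrow> nat set \<times> nat set \<times> (nat \<Rightarrow> nat) \<Rightarrow> bool" where
  "represents M = (\<lambda>(U, Occ, d). U \<subseteq> {..<k} \<and> M NDEM 0 = k \<and>
     (\<forall>i<k. demand_stored M i \<and> M INU i = (if i \<in> U then 1 else 0) \<and>
        (i \<notin> U \<longrightarrow> M DELAY i = d i)) \<and>
     M NU 0 = card U \<and> M NOCC 0 + card U = k \<and> Occ = M OCC ` {..<M NOCC 0})"

text \<open>The longest case is a demand between two leaves: two lookups, two tests and seven
  stores.\<close>

lemma wp_init_demand:
  assumes j: "j < k" "M II 0 = j" "inputs_kept M"
    and post: "\<And>M'. demand_stored M' j \<Longrightarrow> M' INU j = 1 \<Longrightarrow>
      (\<And>i. i \<noteq> j \<Longrightarrow> demand_stored M' i = demand_stored M i \<and> M' INU i = M INU i) \<Longrightarrow> Q M'"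
  shows "wp g init_demand M (2 * lookup_time + 9) Q"
proof -
  obtain s t where Tj: "T ! j = (s, t)" by fastforce
  have verts': "s \<in> pverts G" "t \<in> pverts G" "s \<noteq> t"
    using verts(2,3)[OF j(1)] endpoints_distinct(1)[OF j(1) j(1)] Tj by auto
  have M: "M CENTER 0 = \<nu> x" "M SRC j = \<nu> s" "M DST j = \<nu> t" "M II 0 = j"
    using j Tj by (simp_all add: inputs_kept_def input_mem_simps)
  have eq: "\<nu> s = \<nu> x \<longleftrightarrow> s = x" "\<nu> t = \<nu> x \<longleftrightarrow> t = x"
    using code_eq_iff verts' verts(1) by simp_all
  have take: "take 2 [p, q, r] = [p, q]" "take 3 [p, q, r] = [p, q, r]" for p q r :: nat
    by simp_all
  have final: "Q M'" if "M' AA j = a j" "M' BB j = b j" "M' INU j = 1"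
    "take (M' WSIZE j) [M' WALK0 j, M' WALK1 j, M' WALK2 j] = map \<nu> (walk j)"
    "\<And>i. i \<noteq> j \<Longrightarrow> M' AA i = M AA i \<and> M' BB i = M BB i \<and> M' INU i = M INU i \<and>
      M' WSIZE i = M WSIZE i \<and> M' WALK0 i = M WALK0 i \<and> M' WALK1 i = M WALK1 i \<and>
      M' WALK2 i = M WALK2 i" for M'
    by (rule post) (simp_all add: demand_stored_def walk_stored_def that)
  \<comment> \<open>The rotation puts the continuation first, so that symbolic execution proceeds
    with it and the side conditions wait.\<close>
  note lookup = wp_lookup_a[OF j(1), rotated 3] wp_lookup_b[OF j(1), rotated 3]
  consider "s = x" "t \<noteq> x" | "s \<noteq> x" "t = x" | "s \<noteq> x" "t \<noteq> x" using verts'(3) by auto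
  then show ?thesis
  proof cases
    case 1
    have j_vals: "a j = 0" "walk j = [x, t]"
      using 1 Tj by (simp_all add: csa_a_def csa_walk_def)
    note mem = M Tj j_vals take j(1)
    show ?thesis unfolding init_demand_def
      by (rule wp_seq_if_True, simp add: M 1, (rule wp_seq_assoc | (rule wp_seq_store; simp add: mem) | rule lookup | (rule wp_store; simp?) | rule final)+)
        (use 1 j(3) in \<open>simp_all add: mem inputs_kept_def input_mem_simps\<close>)
  next
    case 2
    have j_vals: "b j = 0" "walk j = [s, x]"
      using 2 Tj by (simp_all add: csa_b_def csa_walk_def)
    note mem = M Tj j_vals take j(1)
    show ?thesis unfolding init_demand_def
      by (rule wp_seq_if_False, simp add: M eq 2, rule wp_seq_if_True, simp add: M eq 2,
          (rule wp_seq_assoc | (rule wp_seq_store; simp add: mem) | rule lookup | (rule wp_store; simp?) | rule final)+)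
        (use 2 j(3) in \<open>simp_all add: mem inputs_kept_def input_mem_simps\<close>)
  next
    case 3
    have j_vals: "walk j = [s, x, t]"
      using 3 Tj by (simp add: csa_walk_def)
    note mem = M Tj j_vals take j(1)
    show ?thesis unfolding init_demand_def
      by (rule wp_seq_if_False, simp add: M eq 3, rule wp_seq_if_False, simp add: M eq 3,
          (rule wp_seq_assoc | (rule wp_seq_store; simp add: mem) | rule lookup | (rule wp_store; simp?) | rule final)+)
        (use 3 j(3) in \<open>simp_all add: mem inputs_kept_def input_mem_simps\<close>)
  qed
qed

lemma wp_init_prog:
  assumes post: "\<And>M. represents M ({..<k}, {}, \<lambda>_. 0) \<Longrightarrow> Q M"
  shows "wp g init_prog M0 (4 + k * (2 * lookup_time + 11)) Q"
proof -
  define I where "I j M \<longleftrightarrow> (\<forall>i<j. demand_stored M i \<and> M INU i = 1)" for j and M :: "reg mem"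
  have demand_upd: "demand_stored (M(r := f)) i = demand_stored M i" if "r \<in> {II, NU, NOCC}" for M r f i
    using that by (auto simp: demand_stored_def walk_stored_def)
  show ?thesis unfolding init_prog_eq
  proof (rule wp_le, rule wp_seq, rule wp_for[where I = I and n = k and m = "2 * lookup_time + 9"])
    fix j and M :: "reg mem"
    assume j: "j < k" "I j M" "M II 0 = j"
      and frame: "\<And>q. q \<notin> writes init_demand \<Longrightarrow> q \<noteq> II \<Longrightarrow> M q = M0 q"
    have "inputs_kept M" using frame by (simp add: inputs_kept_def writes_init_demand)
    then show "wp g init_demand M (2 * lookup_time + 9)
        (\<lambda>M''. I (Suc j) (M''(II := (M'' II)(0 := Suc j))))"
      by (rule wp_init_demand[of j M, rotated 2]) (use j in \<open>auto simp: I_def demand_upd less_Suc_eq\<close>)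
  next
    fix M :: "reg mem"
    assume I: "I k M" and frame: "\<And>q. q \<notin> writes init_demand \<Longrightarrow> q \<noteq> II \<Longrightarrow> M q = M0 q"
    have "M NDEM 0 = k" using frame by (simp add: writes_init_demand input_mem_simps)
    then show "wp g (NU ::= Var NDEM ;; NOCC ::= N 0) M 2 Q"
      using I by (intro wp_intros post)
        (auto simp: represents_def I_def demand_stored_def walk_stored_def)
  qed (simp_all add: I_def input_mem_simps writes_init_demand)
qed

lemma image_fun_upd_lessThan: "(f(n := v)) ` {..<Suc n} = insert v (f ` {..<n})"
  by (auto simp: lessThan_Suc)

text \<open>The minimum takes \<open>3 + 10 k\<close> steps, the slot
  \<open>3 + (q + 1) (7 + 5 q)\<close> with \<open>q \<le> k\<close>, the choice
  \<open>3 + 14 k\<close>, and the five stores 5.\<close>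

abbreviation "round_time \<equiv> 14 + 24 * k + (k + 1) * (7 + 5 * k)"

text \<open>A round simulates one step of the algorithm; for the angel this is the prescribed step
  to \<open>st1\<close>.\<close>

lemma wp_csa_round:
  assumes rep: "represents M (U, Occ, d)" and U: "U \<noteq> {}"
    and target: "g \<Longrightarrow> csa_step len T x (U, Occ, d) st1"
    and post: "\<And>M' st'. represents M' st' \<Longrightarrow> csa_step len T x (U, Occ, d) st' \<Longrightarrow>
      (g \<Longrightarrow> st' = st1) \<Longrightarrow> M' NU 0 < M NU 0 \<Longrightarrow> Q M'"
  shows "wp g csa_round M round_time Q"
proof -
  define m where "m = Min (a ` U)"
  define \<sigma> where "\<sigma> = (LEAST s. m \<le> s \<and> s \<notin> Occ)"
  define max where "max i \<longleftrightarrow> i \<in> U \<and> a i \<le> \<sigma> \<and> (\<forall>j\<in>U. a j \<le> \<sigma> \<longrightarrow> b j \<le> b i)" for i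
  define new where "new i = (U - {i}, insert \<sigma> Occ, d(i := \<sigma> - a i))" for i
  define q where "q = M NOCC 0"
  have Uk: "U \<subseteq> {..<k}" and fin: "finite U" "finite Occ" and Occ: "Occ = M OCC ` {..<q}"
    and q: "q \<le> k" "q + card U = k"
    using rep finite_subset by (auto simp: represents_def q_def)
  have stored: "M AA i = a i" "M BB i = b i" "M INU i = (if i \<in> U then 1 else 0)" if "i < k" for i
    using rep that by (auto simp: represents_def demand_stored_def)
  have step: "csa_step len T x (U, Occ, d) (new i)" if "max i" for i
    unfolding new_def by (rule csa_step.intros[OF U m_def \<sigma>_def]) (use that in \<open>auto simp: max_def\<close>)
  \<comment> \<open>The state determines \<open>m\<close> and \<open>\<sigma>\<close>, so
    \<open>st1\<close> is determined by the demand it selects.\<close>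
  obtain i0 where i0: "g \<Longrightarrow> max i0" "g \<Longrightarrow> st1 = new i0"
  proof (cases g)
    case True
    from target[OF True] show ?thesis
      by cases (use that in \<open>auto simp: max_def new_def m_def \<sigma>_def\<close>)
  qed blast
  have "\<exists>s. m \<le> s \<and> s \<notin> Occ"
    using ex_new_if_finite[of "Occ \<union> {..<m}"] fin(2) by (auto simp: not_less)
  from LeastI_ex[OF this] have "m \<le> \<sigma>" by (simp add: \<sigma>_def)
  moreover have "m \<in> a ` U" unfolding m_def using fin(1) U by (intro Min_in) auto
  ultimately have ex: "\<exists>i\<in>U. a i \<le> \<sigma>" by auto
  let ?stores = "DELAY\<langle>Var BEST\<rangle> ::= Minus (Var SLOT) (Cell AA (Var BEST)) ;;
     INU\<langle>Var BEST\<rangle> ::= N 0 ;;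
     NU ::= Minus (Var NU) (N 1) ;;
     OCC\<langle>Var NOCC\<rangle> ::= Var SLOT ;;
     NOCC ::= Plus (Var NOCC) (N 1)"
  have stores: "wp g ?stores M' 5 Q"
    if i: "M' BEST 0 = i" "max i" "g \<Longrightarrow> i = i0" and slot: "M' SLOT 0 = \<sigma>"
      and fr: "\<And>r. r \<notin> {FOUND, II, BEST, SLOT, JJ, MM} \<Longrightarrow> M' r = M r" for M' i
  proof -
    have iU: "i \<in> U" "i < k" using i(2) Uk by (auto simp: max_def)
    have card: "card (U - {i}) = card U - 1" "0 < card U"
      using iU(1) fin(1) by (auto simp: card_gt_0_iff)
    have mem: "M' NOCC 0 = q" "M' NU 0 = card U" "M' AA i = a i" "M' NDEM 0 = k"
      "M NU 0 = card U"
      using fr stored[OF iU(2)] rep by (simp_all add: q_def represents_def)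
    let ?M = "M'(DELAY := (M' DELAY)(i := \<sigma> - a i), INU := (M' INU)(i := 0),
      NU := (M' NU)(0 := card U - 1), OCC := (M' OCC)(q := \<sigma>), NOCC := (M' NOCC)(0 := Suc q))"
    have "demand_stored ?M j" if "j < k" for j
      using rep that fr by (simp add: represents_def demand_stored_def walk_stored_def)
    moreover have "?M INU j = (if j \<in> U - {i} then 1 else 0)" if "j < k" for j
      using stored[OF that] fr by simp
    moreover have "?M DELAY j = (d(i := \<sigma> - a i)) j" if "j < k" "j \<notin> U - {i}" for j
      using rep that fr by (auto simp: represents_def)
    moreover have "insert \<sigma> Occ = ?M OCC ` {..<Suc q}"
    proof -
      have "?M OCC = (M OCC)(q := \<sigma>)" using fr by simp
      then show ?thesis unfolding Occ by (simp only: image_fun_upd_lessThan)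
    qed
    ultimately have "represents ?M (new i)"
      using Uk q card mem by (auto simp: represents_def new_def)
    then have "Q ?M"
      using step[OF i(2)] i(3) i0(2) card(2) mem by (intro post[of ?M "new i"]) auto
    then show ?thesis
      by (intro wp_intros) (simp_all add: mem i(1) slot)
  qed
  have choose: "wp g (choose_prog ;; ?stores) M' (8 + 14 * k) Q"
    if slot: "M' SLOT 0 = \<sigma>" and fr: "\<And>r. r \<notin> {SLOT, FOUND, JJ, II, MM} \<Longrightarrow> M' r = M r" for M'
  proof (rule wp_le, rule wp_seq, rule wp_choose_prog[where f = a and h = b and ?i0.0 = i0, OF Uk])
    fix M'' i
    assume "M'' BEST 0 = i" "i \<in> U" "a i \<le> M' SLOT 0"
      "\<forall>j\<in>U. a j \<le> M' SLOT 0 \<longrightarrow> b j \<le> b i" "g \<Longrightarrow> i = i0"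
      "\<And>r. r \<notin> {FOUND, II, BEST} \<Longrightarrow> M'' r = M' r"
    then show "wp g ?stores M'' 5 Q"
      using slot fr by (intro stores[of _ i]) (auto simp: max_def)
  qed (use rep stored i0 ex slot fr in \<open>auto simp: max_def represents_def\<close>)
  have slot: "wp g (slot_prog ;; choose_prog ;; ?stores) M' (3 + (q + 1) * (7 + 5 * q) + (8 + 14 * k)) Q"
    if min: "M' MM 0 = m" and fr: "\<And>r. r \<notin> {FOUND, II, MM} \<Longrightarrow> M' r = M r" for M'
  proof (rule wp_seq, rule wp_slot_prog[where Occ = Occ])
    fix M''
    assume "M'' SLOT 0 = (LEAST s. M' MM 0 \<le> s \<and> s \<notin> Occ)"
      "\<And>r. r \<notin> {SLOT, FOUND, JJ} \<Longrightarrow> M'' r = M' r"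
    then show "wp g (choose_prog ;; ?stores) M'' (8 + 14 * k) Q"
      using min fr by (intro choose) (auto simp: \<sigma>_def)
  qed (use fr Occ in \<open>simp_all add: q_def\<close>)
  have round: "wp g csa_round M (1 + (2 + k * (8 + 2)) + (3 + (q + 1) * (7 + 5 * q) + (8 + 14 * k))) Q"
    unfolding csa_round_def
    by (rule wp_seq, rule wp_min_prog[where f = a, OF Uk U])
      (use rep stored slot in \<open>auto simp: represents_def m_def\<close>)
  have "(q + 1) * (7 + 5 * q) \<le> (k + 1) * (7 + 5 * k)"
    using q(1) by (intro mult_mono) auto
  then show ?thesis by (intro wp_le[OF round]) simp
qed

abbreviation "prog_time \<equiv> 5 + k * (2 * lookup_time + 11) + k * Suc round_time"

text \<open>In the angelic reading the invariant adds that the final state of \<open>S0\<close> is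
  still reachable. When no demand is left no step is possible, so the current state is that final
  state.\<close>

lemma wp_csa_prog:
  assumes target: "g \<Longrightarrow> csa_output len T x S0"
    and post: "\<And>M S. csa_output len T x S \<Longrightarrow> mem_represents \<nu> T M S \<Longrightarrow> (g \<Longrightarrow> S = S0) \<Longrightarrow> Q M"
  shows "wp g csa_prog M0 prog_time Q"
proof -
  let ?step = "csa_step len T x"
  let ?init = "({..<k}, {}, \<lambda>_. 0)"
  obtain d0 Occ0 where target': "g \<Longrightarrow> ?step\<^sup>*\<^sup>* ?init ({}, Occ0, d0)" "g \<Longrightarrow> S0 = (d0, walk)"
    using target by (cases g) (auto simp: csa_output_def)
  define I where "I M \<longleftrightarrow> (\<exists>st. represents M st \<and> ?step\<^sup>*\<^sup>* ?init st \<and>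
    (g \<longrightarrow> ?step\<^sup>*\<^sup>* st ({}, Occ0, d0)))" for M
  have no_step: "\<not> ?step ({}, Occ, d) st" for Occ d st
    by (auto elim: csa_step.cases)
  have loop: "wp g (WHILE Less (N 0) (Var NU) DO csa_round) M (Suc (k * Suc round_time)) Q"
    if init: "represents M ?init" for M
  proof -
    have "wp g (WHILE Less (N 0) (Var NU) DO csa_round) M (Suc (M NU 0 * Suc round_time)) Q"
    proof (rule wp_while[where I = I])
      show "I M" using init target' by (auto simp: I_def)
    next
      fix M assume "I M" and bv: "bval (Less (N 0) (Var NU)) M"
      then obtain U Occ d where rep: "represents M (U, Occ, d)"
        and reach: "?step\<^sup>*\<^sup>* ?init (U, Occ, d)"
        and target: "g \<Longrightarrow> ?step\<^sup>*\<^sup>* (U, Occ, d) ({}, Occ0, d0)"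
        by (auto simp: I_def)
      have U: "U \<noteq> {}" using rep bv by (auto simp: represents_def)
      obtain st1 where st1: "g \<Longrightarrow> ?step (U, Occ, d) st1" "g \<Longrightarrow> ?step\<^sup>*\<^sup>* st1 ({}, Occ0, d0)"
      proof (cases g)
        case True
        from target[OF True] show ?thesis
          by (cases rule: converse_rtranclpE) (use U that in auto)
      qed blast
      show "wp g csa_round M round_time (\<lambda>M'. I M' \<and> M' NU 0 < M NU 0)"
        by (rule wp_csa_round[OF rep U st1(1)])
          (use reach st1(2) in \<open>auto simp: I_def intro: rtranclp.rtrancl_into_rtrancl\<close>)
    next
      fix M assume I: "I M" and "\<not> bval (Less (N 0) (Var NU)) M"
      then have "M NU 0 = 0" by simp
      from I obtain U Occ d where rep: "represents M (U, Occ, d)"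
        and reach: "?step\<^sup>*\<^sup>* ?init (U, Occ, d)"
        and target: "g \<Longrightarrow> ?step\<^sup>*\<^sup>* (U, Occ, d) ({}, Occ0, d0)"
        by (auto simp: I_def)
      have card: "card U = 0" using rep \<open>M NU 0 = 0\<close> by (simp add: represents_def)
      have "finite U" using rep finite_subset by (auto simp: represents_def)
      then have U: "U = {}" using card by simp
      show "Q M"
      proof (rule post[of "(d, walk)"])
        show "csa_output len T x (d, walk)" using reach U by (auto simp: csa_output_def)
        show "mem_represents \<nu> T M (d, walk)"
          using rep U by (simp add: mem_represents_def represents_def demand_stored_def walk_stored_def)
        show "(d, walk) = S0" if g
          using target[OF that] target'(2)[OF that] U no_step by (auto elim: converse_rtranclpE)
      qed
    qed
    then show ?thesis using init by (simp add: represents_def)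
  qed
  show ?thesis unfolding csa_prog_eq
    by (rule wp_le, rule wp_seq, rule wp_init_prog, rule loop) auto
qed

section \<open>Bounds in the input size\<close>

text \<open>The delimiter makes each number count at least 1, even 0, which has no bits.\<close>

lemma length_le_input_size: "length es \<le> input_size \<nu> es len T x" "k \<le> input_size \<nu> es len T x"
proof -
  have len: "length ns \<le> (\<Sum>n\<leftarrow>ns. bits n + 1)" for ns
    by (induction ns) auto
  show "length es \<le> input_size \<nu> es len T x"
    using len[of "map len es"] by (simp add: input_size_def input_data_def)
  show "k \<le> input_size \<nu> es len T x"
    using len[of "map (\<nu> \<circ> fst) T"] by (simp add: input_size_def input_data_def)
qed

lemma bits_input_mem: "bits (M0 r i) \<le> input_size \<nu> es len T x"
proof (cases "map_of (input_data \<nu> es len T x) r")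
  case (Some ns)
  show ?thesis
  proof (cases "i < length ns")
    case True
    have "bits (ns ! i) + 1 \<le> (\<Sum>n\<leftarrow>ns. bits n + 1)"
      using True by (intro member_le_sum_list) auto
    also have "\<dots> \<le> input_size \<nu> es len T x"
      unfolding input_size_def using map_of_SomeD[OF Some]
      by (intro member_le_sum_list) (force, simp)
    finally show ?thesis using Some True by (simp add: input_mem_def)
  qed (simp add: input_mem_def Some)
qed (simp add: input_mem_def)

lemma prog_time_le: "prog_time \<le> poly step_poly (input_size \<nu> es len T x)"
proof -
  let ?N = "input_size \<nu> es len T x"
  note le = length_le_input_size
  have "prog_time \<le> 5 + ?N * (2 * (2 + ?N * (3 + 2)) + 11) +
      ?N * Suc (14 + 24 * ?N + (?N + 1) * (7 + 5 * ?N))"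
    using le by (intro add_mono mult_mono Suc_le_mono[THEN iffD2] order.refl) auto
  also have "\<dots> \<le> poly step_poly ?N" by (simp add: step_poly_def algebra_simps)
  finally show ?thesis .
qed

lemma exec_csa_prog:
  assumes "run csa_prog M0 w n M w'" "n \<le> prog_time"
  shows "\<exists>t. exec csa_prog M0 w t M w' \<and> t \<le> poly time_poly (input_size \<nu> es len T x)"
proof -
  let ?N = "input_size \<nu> es len T x" and ?K = "csize csa_prog"
  obtain t where t: "exec csa_prog M0 w t M w'" "t \<le> n * ?K * (?N + n * ?K)"
    using exec_of_run[OF assms(1) order.refl bits_input_mem] by blast
  have n: "n \<le> poly step_poly ?N" using assms(2) prog_time_le by (rule le_trans)
  note t(2)
  also have "n * ?K * (?N + n * ?K) \<le>
      poly step_poly ?N * ?K * (?N + poly step_poly ?N * ?K)"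
    using n by (intro mult_mono add_mono order.refl) auto
  also have "\<dots> = poly time_poly ?N" by (simp add: time_poly_def Let_def mult.commute)
  finally show ?thesis using t(1) by blast
qed

end

theorem theorem3p3:
  shows "\<exists>p :: nat poly.
    \<forall>(G :: 'v pair_pre_digraph) (len :: 'v \<times> 'v \<Rightarrow> nat) (T :: ('v \<times> 'v) list) (x :: 'v).
      tdw_instance G len T \<and> oriented_star G x \<longrightarrow>
        (\<forall>\<nu> es. encoding_of G \<nu> es \<longrightarrow>
           (\<forall>w. \<exists>t M w' S.
              exec csa_prog (input_mem \<nu> es len T x) w t M w' \<and>
              t \<le> poly p (input_size \<nu> es len T x) \<and>
              csa_output len T x S \<and> mem_represents \<nu> T M S) \<and>
           (\<forall>S. csa_output len T x S \<longrightarrow>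
              (\<exists>w t M w'.
                 exec csa_prog (input_mem \<nu> es len T x) w t M w' \<and> mem_represents \<nu> T M S))) \<and>
        (\<forall>S. csa_output len T x S \<longrightarrow>
           feasible G len T S \<and> is_arg_min (sum_cost len T) (feasible G len T) S)"
proof (rule exI[of _ time_poly], intro allI impI conjI)
  fix G :: "'v pair_pre_digraph" and len T x \<nu> es and w :: "bool stream"
  assume "tdw_instance G len T \<and> oriented_star G x" "encoding_of G \<nu> es"
  then interpret encoded_star_instance G len T x \<nu> es by unfold_locales auto
  \<comment> \<open>One good execution for each stream covers all of them, since by
    \<open>exec_deterministic\<close> the stream determines the result.\<close>
  have "wp False csa_prog M0 prog_time (\<lambda>M. \<exists>S. csa_output len T x S \<and> mem_represents \<nu> T M S)"
    by (rule wp_csa_prog) auto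
  then obtain n M w' S where run: "run csa_prog M0 w n M w'" "n \<le> prog_time"
    and S: "csa_output len T x S" "mem_represents \<nu> T M S"
    unfolding wp_def by auto metis
  show "\<exists>t M w' S. exec csa_prog M0 w t M w' \<and>
      t \<le> poly time_poly (input_size \<nu> es len T x) \<and>
      csa_output len T x S \<and> mem_represents \<nu> T M S"
    using exec_csa_prog[OF run] S by blast
next
  fix G :: "'v pair_pre_digraph" and len T x \<nu> es S
  assume "tdw_instance G len T \<and> oriented_star G x" "encoding_of G \<nu> es"
    and S: "csa_output len T x S"
  then interpret encoded_star_instance G len T x \<nu> es by unfold_locales auto
  have "wp True csa_prog M0 prog_time (\<lambda>M. mem_represents \<nu> T M S)"
    by (rule wp_csa_prog[OF S]) auto
  then obtain M where M: "mem_represents \<nu> T M S"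
    and run: "\<And>w'. \<exists>w n. run csa_prog M0 w n M w' \<and> n \<le> prog_time"
    unfolding wp_def by auto
  \<comment> \<open>Any unread rest will do, because the final memory was fixed before it.\<close>
  obtain w n where "run csa_prog M0 w n M undefined" "n \<le> prog_time" using run by blast
  from exec_csa_prog[OF this] show "\<exists>w t M w'. exec csa_prog M0 w t M w' \<and> mem_represents \<nu> T M S"
    using M by blast
next
  fix G :: "'v pair_pre_digraph" and len T x S
  assume "tdw_instance G len T \<and> oriented_star G x" and S: "csa_output len T x S"
  then interpret star_instance G len T x by unfold_locales auto
  show "feasible G len T S" "is_arg_min (sum_cost len T) (feasible G len T) S"
    by (rule csa_output_optimal[OF S])+
qed

end
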